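(* Let $G_n$ denote the smallest integer such that for every finite family $\mathcal{F}$ of pairwise intersecting closed balls in $\mathbb{E}^n$ there exists a set $P\subset\mathbb{E}^n$ of cardinality $G_n$ which pierces $\mathcal{F}$, and let $I_{s,n}:=\max\{I(K): K \text{ is a 2-illuminable spiky ball in } \mathbb{E}^n\}$. Then, as $n\to\infty$, $$G_n\ge \left(\frac{2}{\sqrt{3}}-o(1)\right)^n\quad\text{and}\quad I_{s,n}\ge \left(\frac{2}{\sqrt{3}}-o(1)\right)^n.$$
   Context: $\mathbb{E}^n$ is $n$-dimensional Euclidean space, $\mathbb{B}^n$ its closed unit ball and $\mathbb{S}^{n-1}$ its unit sphere. A set of points $P$ pierces a collection of sets $\mathcal{F}$ if $P\cap F\neq\emptyset$ for every $F\in\mathcal{F}$. For a compact $K\subset\mathbb{E}^n$, a boundary point $x$ of $K$ is illuminated by a direction $u\in\mathbb{S}^{n-1}$ if the half line originating at $x$ in the direction of $u$ intersects the interior of $K$ at points arbitrarily close to $x$. The illumination number $I(K)$ is the smallest number of directions needed to illuminate all boundary points of $K$ (each boundary point is illuminated by at least one of the directions). For points $x_1,\dots,x_m\in\mathbb{E}^n\setminus\mathbb{B}^n$ the spiky ball is $$\mathrm{Sp}[x_1,\dots,x_m]:=\bigcup_{i=1}^m \mathrm{conv}(\mathbb{B}^n\cup\{x_i\}),$$ where $\mathrm{conv}$ is the convex hull; it is always assumed (without loss of generality) that each $x_i$ is a vertex, i.e., $\mathrm{Sp}[x_1,\dots,x_m]\neq \mathrm{Sp}[x_1,\dots,x_{i-1},x_{i+1},\dots,x_m]$.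 The points $x_1,\dots,x_m$ are then the vertices of the spiky ball. A spiky ball is 2-illuminable if any two of its vertices can be illuminated by a single direction. The terms $o(1)$ depend only on $n$ and tend to $0$ as $n\to\infty$. *)

theory Defs
  imports "HOL-Analysis.Analysis" "HOL-Library.Landau_Symbols"
begin

text \<open>
  The dimension \<open>n\<close> varies inside the statement, so it cannot be the cardinality of an index type.
  All the spaces \<open>E\<^sup>n\<close> are therefore realised as subspaces of one real inner product space, the
  finitely supported real sequences with the standard inner product.
\<close>

typedef fsvec = "{f :: nat \<Rightarrow> real. finite {i. f i \<noteq> 0}}"
  morphisms coord Abs_fsvec
  by (rule exI[of _ "\<lambda>_. 0"]) simp

setup_lifting type_definition_fsvec

instantiation fsvec :: real_vector
begin

lift_definition zero_fsvec :: fsvec is "\<lambda>_. 0" by simp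

lift_definition plus_fsvec :: "fsvec \<Rightarrow> fsvec \<Rightarrow> fsvec" is "\<lambda>f g i. f i + g i"
proof -
  fix f g :: "nat \<Rightarrow> real"
  assume "finite {i. f i \<noteq> 0}" "finite {i. g i \<noteq> 0}"
  then show "finite {i. f i + g i \<noteq> 0}"
    by (rule finite_subset[OF _ finite_UnI, rotated]) auto
qed

lift_definition minus_fsvec :: "fsvec \<Rightarrow> fsvec \<Rightarrow> fsvec" is "\<lambda>f g i. f i - g i"
proof -
  fix f g :: "nat \<Rightarrow> real"
  assume "finite {i. f i \<noteq> 0}" "finite {i. g i \<noteq> 0}"
  then show "finite {i. f i - g i \<noteq> 0}"
    by (rule finite_subset[OF _ finite_UnI, rotated]) auto
qed

lift_definition uminus_fsvec :: "fsvec \<Rightarrow> fsvec" is "\<lambda>f i. - f i" by simp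

lift_definition scaleR_fsvec :: "real \<Rightarrow> fsvec \<Rightarrow> fsvec" is "\<lambda>c f i. c * f i"
  by (erule rev_finite_subset) auto

instance
proof
  fix x y z :: fsvec and a b :: real
  show "x + y + z = x + (y + z)" "x + y = y + x" "0 + x = x" "- x + x = 0" "x - y = x + - y"
    "a *\<^sub>R (x + y) = a *\<^sub>R x + a *\<^sub>R y" "(a + b) *\<^sub>R x = a *\<^sub>R x + b *\<^sub>R x"
    "a *\<^sub>R b *\<^sub>R x = (a * b) *\<^sub>R x" "1 *\<^sub>R x = x"
    by (simp_all add: coord_inject[symmetric] fun_eq_iff algebra_simps zero_fsvec.rep_eq
        plus_fsvec.rep_eq minus_fsvec.rep_eq uminus_fsvec.rep_eq scaleR_fsvec.rep_eq)
qed

end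

instantiation fsvec :: real_inner
begin

lift_definition inner_fsvec :: "fsvec \<Rightarrow> fsvec \<Rightarrow> real" is
  "\<lambda>f g. \<Sum>i | f i \<noteq> 0. f i * g i" .

definition norm_fsvec :: "fsvec \<Rightarrow> real" where "norm_fsvec x = sqrt (inner x x)"

definition dist_fsvec :: "fsvec \<Rightarrow> fsvec \<Rightarrow> real" where "dist_fsvec x y = norm (x - y)"

definition sgn_fsvec :: "fsvec \<Rightarrow> fsvec" where "sgn_fsvec x = x /\<^sub>R norm x"

definition uniformity_fsvec :: "(fsvec \<times> fsvec) filter" where
  "uniformity_fsvec = (INF e\<in>{0<..}. principal {(x, y). dist x y < e})"

definition open_fsvec :: "fsvec set \<Rightarrow> bool" where
  "open_fsvec U \<longleftrightarrow> (\<forall>x\<in>U. \<forall>\<^sub>F (x', y) in uniformity. x' = x \<longrightarrow> y \<in> U)"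

lemma inner_fsvec_superset:
  assumes "finite A" "{i. coord x i \<noteq> 0} \<subseteq> A"
  shows "inner x y = (\<Sum>i\<in>A. coord x i * coord y i)"
  unfolding inner_fsvec.rep_eq using assms by (intro sum.mono_neutral_left) auto

lemma finite_coord: "finite {i. coord x i \<noteq> 0}"
  using coord by simp

instance
proof
  fix x y z :: fsvec and a b :: real
  let ?S = "\<lambda>x. {i. coord x i \<noteq> 0}"
  let ?A = "?S x \<union> ?S y"
  have A: "finite ?A" by (simp add: finite_coord)
  have "inner x y = (\<Sum>i\<in>?A. coord x i * coord y i)"
    by (rule inner_fsvec_superset[OF A]) auto
  moreover have "inner y x = (\<Sum>i\<in>?A. coord y i * coord x i)"
    by (rule inner_fsvec_superset[OF A]) auto
  ultimately show "inner x y = inner y x" by (simp add: mult.commute)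
  have "inner (x + y) z = (\<Sum>i\<in>?A. coord (x + y) i * coord z i)"
    by (rule inner_fsvec_superset[OF A]) (auto simp: plus_fsvec.rep_eq)
  moreover have "inner x z = (\<Sum>i\<in>?A. coord x i * coord z i)"
    by (rule inner_fsvec_superset[OF A]) auto
  moreover have "inner y z = (\<Sum>i\<in>?A. coord y i * coord z i)"
    by (rule inner_fsvec_superset[OF A]) auto
  ultimately show "inner (x + y) z = inner x z + inner y z"
    by (simp add: plus_fsvec.rep_eq sum.distrib algebra_simps)
  have "inner (a *\<^sub>R x) y = (\<Sum>i\<in>?S x. coord (a *\<^sub>R x) i * coord y i)"
    by (rule inner_fsvec_superset[OF finite_coord]) (auto simp: scaleR_fsvec.rep_eq)
  then show "inner (a *\<^sub>R x) y = a * inner x y"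
    by (simp add: scaleR_fsvec.rep_eq inner_fsvec.rep_eq sum_distrib_left mult.assoc)
  show "0 \<le> inner x x"
    by (auto simp: inner_fsvec.rep_eq intro!: sum_nonneg)
  have "inner x x = 0 \<longleftrightarrow> (\<forall>i\<in>?S x. coord x i * coord x i = 0)"
    unfolding inner_fsvec.rep_eq by (rule sum_nonneg_eq_0_iff[OF finite_coord]) simp
  also have "\<dots> \<longleftrightarrow> x = 0"
    by (auto simp: coord_inject[symmetric] zero_fsvec.rep_eq fun_eq_iff)
  finally show "inner x x = 0 \<longleftrightarrow> x = 0" .
qed (rule norm_fsvec_def dist_fsvec_def sgn_fsvec_def uniformity_fsvec_def open_fsvec_def)+

end

definition euclid :: "nat \<Rightarrow> fsvec set" where
  "euclid n = {x. \<forall>i\<ge>n. coord x i = 0}"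

text \<open>
  The next three facts confirm that \<open>euclid n\<close> is a copy of \<open>n\<close>-dimensional Euclidean space.
\<close>

lemma subspace_euclid: "subspace (euclid n)"
  by (auto simp: subspace_def euclid_def zero_fsvec.rep_eq plus_fsvec.rep_eq scaleR_fsvec.rep_eq)

lemma coord_euclid: "bij_betw coord (euclid n) {f. \<forall>i\<ge>n. f i = 0}"
proof -
  have "f \<in> coord ` euclid n" if f: "\<forall>i\<ge>n. f i = 0" for f :: "nat \<Rightarrow> real"
  proof -
    have "{i. f i \<noteq> 0} \<subseteq> {..<n}" using f linorder_not_less by blast
    then have "finite {i. f i \<noteq> 0}" by (rule finite_subset) simp
    then have "f = coord (Abs_fsvec f)" by (simp add: Abs_fsvec_inverse)
    moreover from this f have "Abs_fsvec f \<in> euclid n" by (simp add: euclid_def)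
    ultimately show ?thesis by (rule image_eqI)
  qed
  moreover have "coord ` euclid n \<subseteq> {f. \<forall>i\<ge>n. f i = 0}"
    by (simp add: euclid_def image_subset_iff)
  ultimately have "coord ` euclid n = {f. \<forall>i\<ge>n. f i = 0}"
    by blast
  then show ?thesis
    by (simp add: bij_betw_def inj_on_def coord_inject)
qed

lemma inner_euclid:
  assumes "x \<in> euclid n"
  shows "inner x y = (\<Sum>i<n. coord x i * coord y i)"
proof (rule inner_fsvec_superset)
  show "{i. coord x i \<noteq> 0} \<subseteq> {..<n}"
    using assms linorder_not_less unfolding euclid_def by blast
qed simp

abbreviation euclid_top :: "nat \<Rightarrow> fsvec topology" where
  "euclid_top n \<equiv> top_of_set (euclid n)"

definition closed_ball :: "nat \<Rightarrow> fsvec set \<Rightarrow> bool" where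
  "closed_ball n B \<longleftrightarrow> (\<exists>c\<in>euclid n. \<exists>r>0. B = cball c r \<inter> euclid n)"

definition pierces :: "fsvec set \<Rightarrow> fsvec set set \<Rightarrow> bool" where
  "pierces P F \<longleftrightarrow> (\<forall>B\<in>F. P \<inter> B \<noteq> {})"

definition G :: "nat \<Rightarrow> nat" where
  "G n = (LEAST m. \<forall>F. finite F \<and> (\<forall>B\<in>F. closed_ball n B) \<and> pairwise (\<lambda>A B. A \<inter> B \<noteq> {}) F
            \<longrightarrow> (\<exists>P\<subseteq>euclid n. finite P \<and> card P = m \<and> pierces P F))"

definition unit_ball :: "nat \<Rightarrow> fsvec set" where
  "unit_ball n = cball 0 1 \<inter> euclid n"

definition unit_sphere :: "nat \<Rightarrow> fsvec set" where
  "unit_sphere n = sphere 0 1 \<inter> euclid n"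

definition illuminates :: "nat \<Rightarrow> fsvec set \<Rightarrow> fsvec \<Rightarrow> fsvec \<Rightarrow> bool" where
  "illuminates n K u x \<longleftrightarrow>
     u \<in> unit_sphere n \<and> x \<in> euclid_top n frontier_of K \<and>
     (\<forall>\<epsilon>>0. \<exists>t\<ge>0. x + t *\<^sub>R u \<in> euclid_top n interior_of K \<and> dist x (x + t *\<^sub>R u) < \<epsilon>)"

definition illumination_number :: "nat \<Rightarrow> fsvec set \<Rightarrow> nat" where
  "illumination_number n K =
     (LEAST m. \<exists>U\<subseteq>unit_sphere n. finite U \<and> card U = m \<and>
        (\<forall>x \<in> euclid_top n frontier_of K. \<exists>u\<in>U. illuminates n K u x))"

definition spiky :: "nat \<Rightarrow> fsvec set \<Rightarrow> fsvec set" where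
  "spiky n X = (\<Union>x\<in>X. convex hull (unit_ball n \<union> {x}))"

text \<open>
  The points of a spiky ball are collected in a set: the vertex condition already rules out
  repetitions in a list of points.
\<close>

definition spiky_vertices :: "nat \<Rightarrow> fsvec set \<Rightarrow> bool" where
  "spiky_vertices n X \<longleftrightarrow>
     finite X \<and> X \<noteq> {} \<and> X \<subseteq> euclid n - unit_ball n \<and> (\<forall>x\<in>X. spiky n X \<noteq> spiky n (X - {x}))"

definition two_illuminable :: "nat \<Rightarrow> fsvec set \<Rightarrow> bool" where
  "two_illuminable n X \<longleftrightarrow>
     (\<forall>x\<in>X. \<forall>y\<in>X. x \<noteq> y \<longrightarrow>
        (\<exists>u. illuminates n (spiky n X) u x \<and> illuminates n (spiky n X) u y))"

definition I_s :: "nat \<Rightarrow> nat" where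
  "I_s n = Max {illumination_number n (spiky n X) | X. spiky_vertices n X \<and> two_illuminable n X}"

end

theory Submission
  imports Defs "HOL-Probability.Probability_Measure" "HOL-Real_Asymp.Real_Asymp"
begin

text \<open>
  Both bounds rest on one family of unit vectors \<open>v\<^sub>0, \<dots>, v\<^bsub>N-1\<^esub>\<close> of size
  \<open>(2 / \<surd>3 - o(1))\<^sup>n\<close> with two properties: any two of them enclose an angle less than \<open>2\<pi>/3\<close>,
  and no spherical cap of angular radius \<open>\<pi>/3\<close> contains more than \<open>K = 2n\<^sup>2 + 2\<close> of them. To cover
  them with such caps one therefore needs at least \<open>N / K\<close> caps.

  For \<open>G\<close>, take the balls of radius \<open>\<surd>3/2\<close> about the \<open>v\<^sub>i\<close>. They meet pairwise because the
  distances are less than \<open>\<surd>3\<close>, and a point within \<open>\<surd>3/2\<close> of \<open>v\<^sub>i\<close> is seen from the origin at an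
  angle of at most \<open>\<pi>/3\<close> from \<open>v\<^sub>i\<close>. For \<open>I_s\<close>, take the vertices \<open>(2 / \<surd>3) v\<^sub>i\<close>. The spike at
  such a vertex is a cone of half angle \<open>\<pi>/3\<close>, so two vertices are illuminated by the
  direction opposite to the bisector of their angle, while a direction \<open>u\<close> illuminates the vertex only if \<open>-u\<close> is within \<open>\<pi>/3\<close> of \<open>v\<^sub>i\<close>.
  In both situations a solution gives a covering by caps.

  The family exists because a cap of angular radius \<open>\<pi>/3\<close> has relative volume at most
  \<open>(\<surd>3/2)\<^sup>n\<close>: the part of the unit ball above it fits into a ball of radius \<open>\<surd>3/2\<close>. Being at an angle
  of at least \<open>2\<pi>/3\<close> from a given vector also means lying in such a cap, so up to about
  \<open>(2 / \<surd>3)\<^sup>n\<close> vectors can be chosen one after the other with room to spare. The caps are kept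
  sparse at the same time by the method of conditional expectations, applied to
  the caps (of slightly larger radius) about the points of a finite grid.

  The numbers \<open>G n\<close> and \<open>I_s n\<close> are a least and a greatest element, so it also has to be shown
  that the minimum and the maximum exist. This is the same geometric fact twice: if every ball of
  a family is at least as large as some fixed one and comes close to it, then a grid scaled to that smallest ball
  pierces all of them. For spiky balls the family consists of balls that span the cones
  of illuminating directions.
\<close>

section \<open>Greedy choice with conditional expectations\<close>

text \<open>
  The points are chosen one at a time. The forbidden sets of the earlier points cover less than
  half of the space. The average increase of the potential \<open>\<Sum>u. 2 ^ (hits of C u)\<close> is at
  most \<open>p\<close> times the potential, so by Markov's inequality some permitted point increases it by a
  factor of at most \<open>1 + 2p\<close>. A bound on the potential bounds the number of hits of every \<open>C u\<close>
  by its logarithm.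
\<close>

lemma (in prob_space) greedy_avoid_and_balance:
  fixes C :: "'u \<Rightarrow> 'a set" and D :: "'a \<Rightarrow> 'a set" and p :: real
  assumes U: "finite U" "U \<noteq> {}"
    and C: "\<And>u. u \<in> U \<Longrightarrow> C u \<in> events" "\<And>u. u \<in> U \<Longrightarrow> prob (C u) \<le> p"
    and D: "\<And>x. x \<in> space M \<Longrightarrow> D x \<in> events" "\<And>x. x \<in> space M \<Longrightarrow> prob (D x) \<le> p"
    and p: "0 < p" "2 * real N * p \<le> 1"
  shows "\<exists>x. (\<forall>i<N. x i \<in> space M) \<and> (\<forall>j<N. \<forall>i<j. x j \<notin> D (x i)) \<and>
           (\<Sum>u\<in>U. 2 ^ card {i. i < N \<and> x i \<in> C u}) \<le> real (card U) * (1 + 2 * p) ^ N"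
  using p(2)
proof (induction N)
  case 0
  show ?case by simp
next
  case (Suc k)
  have "2 * real k * p \<le> 1" and k: "2 * (real k * p) < 1"
    using Suc.prems p(1) by (auto simp: algebra_simps)
  then obtain x where x: "\<And>i. i < k \<Longrightarrow> x i \<in> space M" "\<And>i j. j < k \<Longrightarrow> i < j \<Longrightarrow> x j \<notin> D (x i)"
    and sum: "(\<Sum>u\<in>U. 2 ^ card {i. i < k \<and> x i \<in> C u}) \<le> real (card U) * (1 + 2 * p) ^ k"
    using Suc.IH by blast
  define w :: "'u \<Rightarrow> real" where "w u = 2 ^ card {i. i < k \<and> x i \<in> C u}" for u
  define \<Phi> where "\<Phi> = (\<Sum>u\<in>U. w u)"
  \<comment> \<open>\<open>w u\<close> are the current weights, \<open>g y\<close> is the increase of the potential if \<open>y\<close> is added,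
    and \<open>W\<close> consists of the permitted points.\<close>
  define g where "g y = (\<Sum>u\<in>U. w u * indicator (C u) y)" for y
  define W where "W = space M - (\<Union>i<k. D (x i))"
  have w_pos: "w u > 0" for u by (simp add: w_def)
  have \<Phi>_pos: "\<Phi> > 0" unfolding \<Phi>_def using U w_pos by (intro sum_pos) auto
  have DU: "(\<Union>i<k. D (x i)) \<in> events" using D x by (intro sets.finite_UN) auto
  then have W: "W \<in> events" unfolding W_def by auto
  have "prob (\<Union>i<k. D (x i)) \<le> (\<Sum>i<k. prob (D (x i)))"
    using D x by (intro finite_measure_subadditive_finite) auto
  also have "\<dots> \<le> (\<Sum>i<k. p)" using D x by (intro sum_mono) auto
  finally have W_half: "prob W > 1 / 2"
    unfolding W_def using prob_compl[OF DU] k by simp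
  have g_int: "integrable M g"
    unfolding g_def using C by (intro Bochner_Integration.integrable_sum integrable_mult_right) (simp add: less_top[symmetric])
  have g_nonneg: "g y \<ge> 0" for y
    unfolding g_def using w_pos by (intro sum_nonneg mult_nonneg_nonneg) (auto simp: less_imp_le)
  have "(\<integral>y. g y \<partial>M) = (\<Sum>u\<in>U. w u * prob (C u))"
    unfolding g_def using C by (subst Bochner_Integration.integral_sum) (auto simp: less_top[symmetric])
  also have "\<dots> \<le> (\<Sum>u\<in>U. w u * p)"
    using C w_pos by (intro sum_mono mult_left_mono) (auto simp: less_imp_le)
  finally have g_le: "(\<integral>y. g y \<partial>M) \<le> p * \<Phi>" by (simp add: \<Phi>_def sum_distrib_left mult.commute)
  have "\<exists>y\<in>W. g y < 2 * p * \<Phi>"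
  proof (rule ccontr)
    assume "\<not> ?thesis"
    then have "2 * p * \<Phi> * indicator W y \<le> g y" for y
      using g_nonneg[of y] by (auto simp: indicator_def not_less)
    then have "(\<integral>y. 2 * p * \<Phi> * indicator W y \<partial>M) \<le> (\<integral>y. g y \<partial>M)"
      using W g_int by (intro integral_mono) (auto simp: less_top[symmetric])
    then have "2 * p * \<Phi> * prob W \<le> p * \<Phi>" using W g_le by simp
    moreover have "2 * (p * \<Phi>) * (1 / 2) < 2 * (p * \<Phi>) * prob W"
      using W_half p \<Phi>_pos by (intro mult_strict_left_mono) auto
    ultimately show False by simp
  qed
  then obtain y where y: "y \<in> W" "g y < 2 * p * \<Phi>" by blast
  define x' where "x' = x(k := y)"
  have split: "2 ^ card {i. i < Suc k \<and> x' i \<in> C u} = w u + w u * indicator (C u) y" for u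
  proof -
    have "{i. i < Suc k \<and> x' i \<in> C u} =
        {i. i < k \<and> x i \<in> C u} \<union> (if y \<in> C u then {k} else {})"
      by (auto simp: x'_def less_Suc_eq)
    then show ?thesis by (auto simp: w_def indicator_def)
  qed
  have "(\<Sum>u\<in>U. 2 ^ card {i. i < Suc k \<and> x' i \<in> C u}) = \<Phi> + g y"
    by (simp add: split \<Phi>_def g_def sum.distrib)
  also have "\<dots> \<le> (1 + 2 * p) * \<Phi>" using y by (simp add: algebra_simps)
  also have "\<dots> \<le> (1 + 2 * p) * (real (card U) * (1 + 2 * p) ^ k)"
    using sum p by (intro mult_left_mono) (auto simp: \<Phi>_def w_def)
  finally have "(\<Sum>u\<in>U. 2 ^ card {i. i < Suc k \<and> x' i \<in> C u}) \<le> real (card U) * (1 + 2 * p) ^ Suc k"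
    by (simp add: algebra_simps)
  moreover have "\<forall>i<Suc k. x' i \<in> space M" using x y by (auto simp: x'_def less_Suc_eq W_def)
  moreover have "\<forall>j<Suc k. \<forall>i<j. x' j \<notin> D (x' i)"
    using x y by (auto simp: x'_def less_Suc_eq W_def)
  ultimately show ?case by blast
qed

section \<open>Lebesgue measure on \<open>n\<close> coordinates\<close>

definition fsv :: "nat \<Rightarrow> (nat \<Rightarrow> real) \<Rightarrow> fsvec" where
  "fsv n f = Abs_fsvec (\<lambda>i. if i < n then f i else 0)"

lemma coord_fsv: "coord (fsv n f) i = (if i < n then f i else 0)"
proof -
  have "{i. (if i < n then f i else 0) \<noteq> 0} \<subseteq> {..<n}" by auto
  then have "finite {i. (if i < n then f i else 0) \<noteq> 0}" by (rule finite_subset) simp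
  then show ?thesis by (simp add: fsv_def Abs_fsvec_inverse)
qed

lemma fsv_euclid [simp]: "fsv n f \<in> euclid n"
  by (simp add: euclid_def coord_fsv)

lemma fsvec_eqI: "(\<And>i. coord x i = coord y i) \<Longrightarrow> x = y"
  by (simp add: coord_inject[symmetric] fun_eq_iff)

lemma norm_euclid:
  assumes "x \<in> euclid n"
  shows "norm x = sqrt (\<Sum>i<n. (coord x i)\<^sup>2)"
  using inner_euclid[OF assms, of x] by (simp add: norm_eq_sqrt_inner power2_eq_square)

text \<open>
  The dimension is a number and not a type, so volumes are computed on the finite product of
  copies of the real line, and transported to \<open>euclid n\<close> by \<open>fsv n\<close>.
\<close>

definition leb :: "nat \<Rightarrow> (nat \<Rightarrow> real) measure" where
  "leb n = Pi\<^sub>M {..<n} (\<lambda>_. lborel)"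

lemma measurable_inner_fsv [measurable]: "(\<lambda>f. inner u (fsv n f)) \<in> borel_measurable (leb n)"
proof -
  have "(\<lambda>f. inner u (fsv n f)) = (\<lambda>f. \<Sum>i<n. f i * coord u i)"
    by (subst inner_commute, subst inner_euclid[OF fsv_euclid]) (auto simp: coord_fsv)
  also have "\<dots> \<in> borel_measurable (leb n)" unfolding leb_def by measurable
  finally show ?thesis .
qed

lemma measurable_norm_fsv [measurable]: "(\<lambda>f. norm (fsv n f)) \<in> borel_measurable (leb n)"
proof -
  have "(\<lambda>f. norm (fsv n f)) = (\<lambda>f. sqrt (\<Sum>i<n. (f i)\<^sup>2))"
    by (subst norm_euclid[OF fsv_euclid]) (auto simp: coord_fsv)
  also have "\<dots> \<in> borel_measurable (leb n)" unfolding leb_def by measurable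
  finally show ?thesis .
qed

lemma measurable_norm_fsv_diff [measurable]: 
  assumes "c \<in> euclid n"
  shows "(\<lambda>f. norm (fsv n f - c)) \<in> borel_measurable (leb n)"
proof -
  have "norm (fsv n f - c) = sqrt (\<Sum>i<n. (f i - coord c i)\<^sup>2)" for f
    by (subst norm_euclid[OF subspace_diff[OF subspace_euclid fsv_euclid assms]])
       (simp add: coord_fsv minus_fsvec.rep_eq)
  moreover have "(\<lambda>f. sqrt (\<Sum>i<n. (f i - coord c i)\<^sup>2)) \<in> borel_measurable (leb n)"
    unfolding leb_def by measurable
  ultimately show ?thesis by simp
qed

text \<open>
  On boxes both sides are products of lengths, and a length is multiplied by \<open>r\<close> under
  \<open>y \<mapsto> c + r y\<close>; boxes determine the product measure. All that is used of the volume is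
  its behaviour under homotheties, so that ratios of volumes of balls are known without the volume
  of any ball.
\<close>

lemma leb_affine:
  assumes r: "r > 0"
  shows "leb n = density (distr (leb n) (leb n) (\<lambda>f. \<lambda>i\<in>{..<n}. c i + r * f i)) (\<lambda>_. ennreal (r ^ n))"
    (is "_ = density (distr _ _ ?T) _")
proof -
  interpret product_sigma_finite "\<lambda>_::nat. lborel :: real measure" ..
  have T: "?T \<in> measurable (leb n) (leb n)"
    unfolding leb_def by measurable
  have "Pi\<^sub>M {..<n} (\<lambda>_. lborel) = density (distr (leb n) (leb n) ?T) (\<lambda>_. ennreal (r ^ n))"
  proof (rule PiM_eqI[symmetric])
    show "sets (density (distr (leb n) (leb n) ?T) (\<lambda>_. ennreal (r ^ n))) = sets (Pi\<^sub>M {..<n} (\<lambda>_. lborel))"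
      by (simp add: leb_def)
  next
    fix A :: "nat \<Rightarrow> real set"
    assume A: "\<And>i. i \<in> {..<n} \<Longrightarrow> A i \<in> sets lborel"
    have PA: "Pi\<^sub>E {..<n} A \<in> sets (leb n)" unfolding leb_def using A by (intro sets_PiM_I_finite) auto
    have pre: "(\<lambda>y. c i + r * y) -` A i \<in> sets lborel" if "i < n" for i
    proof -
      have "(\<lambda>y. c i + r * y) \<in> measurable lborel lborel" by measurable
      from measurable_sets[OF this, of "A i"] A that show ?thesis by simp
    qed
    have one: "emeasure lborel (A i) = ennreal r * emeasure lborel ((\<lambda>y. c i + r * y) -` A i)" if "i < n" for i
    proof -
      have "emeasure lborel (A i) =
          emeasure (density (distr lborel borel (\<lambda>x. c i + r * x)) (\<lambda>_. ennreal \<bar>r\<bar>)) (A i)"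
        using r by (subst lborel_real_affine[of r "c i"]) auto
      also have "\<dots> = ennreal r * emeasure lborel ((\<lambda>y. c i + r * y) -` A i)"
        using r A[of i] that
        by (subst emeasure_density_const) (auto simp: emeasure_distr)
      finally show ?thesis .
    qed
    have "?T -` Pi\<^sub>E {..<n} A \<inter> space (leb n) = Pi\<^sub>E {..<n} (\<lambda>i. (\<lambda>y. c i + r * y) -` A i)"
      by (auto simp: leb_def space_PiM PiE_iff extensional_def)
    then have "emeasure (density (distr (leb n) (leb n) ?T) (\<lambda>_. ennreal (r ^ n))) (Pi\<^sub>E {..<n} A)
        = ennreal (r ^ n) * emeasure (leb n) (Pi\<^sub>E {..<n} (\<lambda>i. (\<lambda>y. c i + r * y) -` A i))"
      using PA T by (subst emeasure_density_const) (auto simp: emeasure_distr)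
    also have "\<dots> = ennreal (r ^ n) * (\<Prod>i<n. emeasure lborel ((\<lambda>y. c i + r * y) -` A i))"
      unfolding leb_def using pre by (subst emeasure_PiM) auto
    also have "\<dots> = (\<Prod>i<n. emeasure lborel (A i))"
      using r by (simp add: one prod.distrib ennreal_power)
    finally show "emeasure (density (distr (leb n) (leb n) ?T) (\<lambda>_. ennreal (r ^ n))) (Pi\<^sub>E {..<n} A)
        = (\<Prod>i<n. emeasure lborel (A i))" .
  qed simp
  then show ?thesis by (simp add: leb_def)
qed

lemma emeasure_leb_ball:
  assumes r: "r > 0" and c: "c \<in> euclid n"
  shows "emeasure (leb n) {f \<in> space (leb n). norm (fsv n f - c) \<le> r} =
     ennreal (r ^ n) * emeasure (leb n) {f \<in> space (leb n). norm (fsv n f) \<le> 1}"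
proof -
  let ?T = "\<lambda>f. \<lambda>i\<in>{..<n}. coord c i + r * f i"
  let ?B = "{f \<in> space (leb n). norm (fsv n f - c) \<le> r}"
  have B: "?B \<in> sets (leb n)" using c by measurable
  have T: "?T \<in> measurable (leb n) (leb n)"
    unfolding leb_def by measurable
  have "fsv n (?T f) = c + r *\<^sub>R fsv n f" for f
    using c by (intro fsvec_eqI) (auto simp: coord_fsv plus_fsvec.rep_eq scaleR_fsvec.rep_eq euclid_def)
  then have "norm (fsv n (?T f) - c) = r * norm (fsv n f)" for f
    using r by simp
  then have pre: "?T -` ?B \<inter> space (leb n) = {f \<in> space (leb n). norm (fsv n f) \<le> 1}"
    using measurable_space[OF T] r by auto
  have "emeasure (leb n) ?B = emeasure (density (distr (leb n) (leb n) ?T) (\<lambda>_. ennreal (r ^ n))) ?B"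
    using leb_affine[OF r, of n "coord c"] by simp
  also have "\<dots> = ennreal (r ^ n) * emeasure (leb n) (?T -` ?B \<inter> space (leb n))"
    using B T by (subst emeasure_density_const) (auto simp: emeasure_distr)
  finally show ?thesis by (simp only: pre)
qed

text \<open>
  The unit ball lies between two cubes.
\<close>

lemma leb_unit_ball_pos_finite:
  shows "emeasure (leb n) {f \<in> space (leb n). norm (fsv n f) \<le> 1} \<noteq> 0"
    and "emeasure (leb n) {f \<in> space (leb n). norm (fsv n f) \<le> 1} < \<infinity>"
proof -
  interpret product_sigma_finite "\<lambda>_::nat. lborel :: real measure" ..
  let ?B = "{f \<in> space (leb n). norm (fsv n f) \<le> 1}"
  have B: "?B \<in> sets (leb n)" by measurable
  have box: "emeasure (leb n) (Pi\<^sub>E {..<n} (\<lambda>_. {-a..a})) = ennreal ((2 * a) ^ n)" if "a \<ge> 0" for a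
    unfolding leb_def using that by (subst emeasure_PiM) (auto simp: ennreal_power)
  define a where "a = 1 / (real n + 1)"
  have a: "a > 0" by (simp add: a_def)
  have sub: "Pi\<^sub>E {..<n} (\<lambda>_. {-a..a}) \<subseteq> ?B"
  proof
    fix f assume f: "f \<in> Pi\<^sub>E {..<n} (\<lambda>_. {-a..a})"
    have "norm (fsv n f) ^ 2 = (\<Sum>i<n. (f i)\<^sup>2)"
      by (subst norm_euclid[OF fsv_euclid]) (auto simp: coord_fsv sum_nonneg)
    also have "\<dots> \<le> (\<Sum>i<n. a\<^sup>2)"
      using f by (intro sum_mono) (auto simp: PiE_iff abs_le_iff power2_le_iff_abs_le[OF less_imp_le[OF a]] minus_le_iff)
    also have "\<dots> \<le> 1" by (simp add: a_def power_divide divide_le_eq power2_eq_square algebra_simps add_pos_nonneg)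
    finally have "norm (fsv n f) \<le> 1" by (simp add: abs_square_le_1)
    with f show "f \<in> ?B" by (auto simp: leb_def space_PiM PiE_iff)
  qed
  show "emeasure (leb n) ?B \<noteq> 0"
    using emeasure_mono[OF sub B] box[of a] a by (auto simp: ennreal_zero_less_mult_iff)
  have "?B \<subseteq> Pi\<^sub>E {..<n} (\<lambda>_. {-1..1})"
  proof
    fix f assume f: "f \<in> ?B"
    have "\<bar>f i\<bar> \<le> 1" if "i < n" for i
    proof -
      have "(f i)\<^sup>2 \<le> (\<Sum>i<n. (f i)\<^sup>2)" using that by (intro member_le_sum) auto
      also have "\<dots> = norm (fsv n f) ^ 2"
        by (subst norm_euclid[OF fsv_euclid]) (auto simp: coord_fsv sum_nonneg)
      also have "\<dots> \<le> 1" using f by (simp add: abs_square_le_1)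
      finally show ?thesis by (simp add: abs_square_le_1)
    qed
    with f show "f \<in> Pi\<^sub>E {..<n} (\<lambda>_. {-1..1})"
      by (auto simp: leb_def space_PiM PiE_iff abs_le_iff minus_le_iff)
  qed
  then have "emeasure (leb n) ?B \<le> emeasure (leb n) (Pi\<^sub>E {..<n} (\<lambda>_. {-1..1}))"
    by (rule emeasure_mono) (auto simp: leb_def intro!: sets_PiM_I_finite)
  also have "\<dots> = ennreal ((2 * 1) ^ n)" using box[of 1] by simp
  finally have "emeasure (leb n) ?B \<le> ennreal ((2 * 1) ^ n)" .
  then show "emeasure (leb n) ?B < \<infinity>" by (auto simp: less_top[symmetric] top_unique)
qed

section \<open>Caps have small volume\<close>

definition unif :: "nat \<Rightarrow> (nat \<Rightarrow> real) measure" where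
  "unif n = uniform_measure (leb n) {f \<in> space (leb n). norm (fsv n f) \<le> 1}"

lemma prob_space_unif: "prob_space (unif n)"
  unfolding unif_def using leb_unit_ball_pos_finite[of n]
  by (intro prob_space_uniform_measure) auto

text \<open>
  The part of the space that is seen from the origin through the spherical cap about \<open>u\<close>. The
  inequality is homogeneous, so the origin belongs to every cap.
\<close>

definition cap :: "nat \<Rightarrow> real \<Rightarrow> fsvec \<Rightarrow> (nat \<Rightarrow> real) set" where
  "cap n t u = {f \<in> space (leb n). t * norm (fsv n f) \<le> inner u (fsv n f)}"

lemma sets_cap [measurable]: "cap n t u \<in> sets (unif n)"
  unfolding cap_def unif_def by simp

text \<open>
  For \<open>norm x = 1\<close> the squared distance to \<open>t u\<close> is at most \<open>1 - 2 t\<^sup>2 + t\<^sup>2\<close>, and for \<open>x = 0\<close> it is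
  at most \<open>t\<^sup>2 \<le> 1 - t\<^sup>2\<close>. In between, the bound is a convex function of \<open>norm x\<close>. This is why the
  condition \<open>t\<^sup>2 \<le> 1 / 2\<close> appears: for thinner caps the apex at the origin sticks out of the ball.
\<close>

lemma cap_point_near_centre:
  fixes u x :: "'a :: real_inner"
  assumes u: "norm u \<le> 1" and x: "norm x \<le> 1" and t: "0 \<le> t" "t\<^sup>2 \<le> 1 / 2"
    and cap: "t * norm x \<le> inner u x"
  shows "norm (x - t *\<^sub>R u) \<le> sqrt (1 - t\<^sup>2)"
proof -
  have "(norm (x - t *\<^sub>R u))\<^sup>2 = (norm x)\<^sup>2 - 2 * t * inner u x + t\<^sup>2 * (norm u)\<^sup>2"
    unfolding power2_norm_eq_inner by (simp add: inner_diff inner_commute power2_eq_square algebra_simps)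
  also have "\<dots> \<le> (norm x)\<^sup>2 - 2 * t * (t * norm x) + t\<^sup>2 * 1"
    using assms by (intro add_mono diff_mono mult_left_mono) (auto simp: abs_square_le_1)
  also have "\<dots> = 1 - t\<^sup>2 - (1 - norm x) * (norm x + (1 - 2 * t\<^sup>2))"
    by (simp add: power2_eq_square algebra_simps)
  also have "\<dots> \<le> 1 - t\<^sup>2"
    using t x by simp
  finally show ?thesis by (rule real_le_rsqrt)
qed

lemma prob_cap_le:
  assumes u: "u \<in> euclid n" "norm u \<le> 1" and t: "0 \<le> t" "t\<^sup>2 \<le> 1 / 2"
  shows "measure (unif n) (cap n t u) \<le> sqrt (1 - t\<^sup>2) ^ n"
proof -
  let ?B = "{f \<in> space (leb n). norm (fsv n f) \<le> 1}"
  let ?r = "sqrt (1 - t\<^sup>2)"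
  let ?D = "{f \<in> space (leb n). norm (fsv n f - t *\<^sub>R u) \<le> ?r}"
  have r: "?r > 0" using t by simp
  have tu: "t *\<^sub>R u \<in> euclid n" using u by (simp add: subspace_scale subspace_euclid)
  have B: "?B \<in> sets (leb n)" by measurable
  have D: "?D \<in> sets (leb n)" using tu by measurable
  have "?B \<inter> cap n t u \<subseteq> ?D"
    using cap_point_near_centre[OF u(2) _ t] by (auto simp: cap_def)
  then have "emeasure (leb n) (?B \<inter> cap n t u) \<le> emeasure (leb n) ?D"
    using D by (rule emeasure_mono)
  also have "\<dots> = ennreal (?r ^ n) * emeasure (leb n) ?B"
    by (rule emeasure_leb_ball[OF r tu])
  finally have "emeasure (unif n) (cap n t u) \<le> ennreal (?r ^ n) * emeasure (leb n) ?B / emeasure (leb n) ?B"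
    unfolding unif_def using B sets_cap[of n t u]
    by (subst emeasure_uniform_measure) (auto simp: unif_def intro!: divide_right_mono_ennreal)
  also have "\<dots> = ennreal (?r ^ n)"
    using leb_unit_ball_pos_finite[of n] by (intro ennreal_mult_divide_eq) auto
  finally show ?thesis
    using r by (simp add: measure_def enn2real_leI)
qed

section \<open>Grids as nets of the unit ball\<close>

definition grid :: "nat \<Rightarrow> nat \<Rightarrow> fsvec set" where
  "grid n m = (\<lambda>k. fsv n (\<lambda>i. real_of_int (k i) / real m)) ` Pi\<^sub>E {..<n} (\<lambda>_. {- int m..int m})"

lemma finite_grid [simp]: "finite (grid n m)"
  unfolding grid_def by (intro finite_imageI finite_PiE) auto

lemma card_grid_le: "card (grid n m) \<le> (2 * m + 1) ^ n"
proof -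
  have "card (grid n m) \<le> card (Pi\<^sub>E {..<n} (\<lambda>_. {- int m..int m}))"
    unfolding grid_def by (intro card_image_le finite_PiE) auto
  also have "\<dots> = (2 * m + 1) ^ n" by (simp add: card_PiE nat_add_distrib nat_mult_distrib)
  finally show ?thesis .
qed

lemma grid_euclid: "g \<in> grid n m \<Longrightarrow> g \<in> euclid n"
  unfolding grid_def by (elim imageE) simp

text \<open>
  Rounding towards zero rather than to the nearest grid point keeps the norm from growing. The
  volume bound for caps needs centres in the unit ball.
\<close>

lemma round_towards_zero:
  fixes a :: real
  assumes "\<bar>a\<bar> \<le> 1" "m > 0"
  obtains k :: int where "k \<in> {- int m..int m}" "\<bar>k / real m\<bar> \<le> \<bar>a\<bar>" "\<bar>a - k / real m\<bar> \<le> 1 / real m"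
proof -
  define b where "b = \<bar>a\<bar> * real m"
  have b: "0 \<le> b" "b \<le> real m" using assms by (auto simp: b_def mult_left_le_one_le)
  define l where "l = \<lfloor>b\<rfloor>"
  have l: "0 \<le> l" "l \<le> int m" "real_of_int l \<le> b" "b \<le> l + 1"
    using b unfolding l_def by (linarith | simp add: floor_le_iff le_floor_iff)+
  define q where "q = real_of_int l / real m"
  have q: "0 \<le> q" "q \<le> \<bar>a\<bar>" "\<bar>a\<bar> \<le> q + 1 / real m"
    using l assms by (auto simp: q_def b_def field_simps)
  show thesis
  proof (cases "a \<ge> 0")
    case True
    with l q show thesis by (intro that[of l]) (auto simp: q_def[symmetric])
  next
    case False
    with l q show thesis by (intro that[of "-l"]) (auto simp: q_def[symmetric])
  qed
qed

lemma grid_approx: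
  assumes w: "w \<in> euclid n" "norm w \<le> 1" and m: "m > 0"
  obtains g where "g \<in> grid n m" "norm g \<le> norm w" "norm (w - g) \<le> sqrt (real n) / real m"
proof -
  have abs: "\<bar>coord w i\<bar> \<le> 1" if "i < n" for i
  proof -
    have "(coord w i)\<^sup>2 \<le> (\<Sum>i<n. (coord w i)\<^sup>2)" using that by (intro member_le_sum) auto
    also have "\<dots> = (norm w)\<^sup>2" using w by (simp add: norm_euclid sum_nonneg)
    also have "\<dots> \<le> 1" using w by (simp add: abs_square_le_1)
    finally show ?thesis by (simp add: abs_square_le_1)
  qed
  have "\<exists>k::int. k \<in> {- int m..int m} \<and> \<bar>k / real m\<bar> \<le> \<bar>coord w i\<bar> \<and> \<bar>coord w i - k / real m\<bar> \<le> 1 / real m"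
    if "i < n" for i
    using round_towards_zero[OF abs[OF that] m] by blast
  then obtain k :: "nat \<Rightarrow> int" where k: "\<And>i. i < n \<Longrightarrow> k i \<in> {- int m..int m}"
    "\<And>i. i < n \<Longrightarrow> \<bar>k i / real m\<bar> \<le> \<bar>coord w i\<bar>" "\<And>i. i < n \<Longrightarrow> \<bar>coord w i - k i / real m\<bar> \<le> 1 / real m"
    by metis
  define g where "g = fsv n (\<lambda>i. k i / real m)"
  have "g = fsv n (\<lambda>i. restrict k {..<n} i / real m)"
    by (rule fsvec_eqI) (simp add: g_def coord_fsv)
  then have "g \<in> grid n m" using k(1)
    unfolding grid_def by (intro image_eqI[where x = "restrict k {..<n}"]) (simp_all add: PiE_iff)
  moreover have "norm g \<le> norm w"
  proof -
    have g: "g \<in> euclid n" by (simp add: g_def)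
    show ?thesis
      unfolding norm_euclid[OF w(1)] norm_euclid[OF g]
      using k(2) by (intro real_sqrt_le_mono sum_mono) (simp add: g_def coord_fsv flip: abs_le_square_iff)
  qed
  moreover have "norm (w - g) \<le> sqrt (real n) / real m"
  proof -
    have "w - g \<in> euclid n" using w by (simp add: g_def subspace_diff subspace_euclid)
    then have "norm (w - g) = sqrt (\<Sum>i<n. (coord (w - g) i)\<^sup>2)" by (rule norm_euclid)
    also have "\<dots> \<le> sqrt (\<Sum>i<n. (1 / real m)\<^sup>2)"
    proof (intro real_sqrt_le_mono sum_mono)
      fix i assume "i \<in> {..<n}"
      then show "(coord (w - g) i)\<^sup>2 \<le> (1 / real m)\<^sup>2"
        using k(3)[of i] unfolding abs_le_square_iff[symmetric]
        by (simp add: g_def coord_fsv minus_fsvec.rep_eq)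
    qed
    also have "\<dots> = sqrt (real n) / real m"
      using m by (simp add: real_sqrt_mult real_sqrt_divide power_divide)
    finally show ?thesis .
  qed
  ultimately show thesis by (rule that)
qed

text \<open>
  The mesh \<open>1 / n\<^sup>2\<close> is fine enough to replace the cap height \<open>1/2\<close> by \<open>1/2 - 1/n\<close>, which costs
  only a constant factor in the \<open>n\<close>-th power.
\<close>

corollary grid_approx_square:
  assumes "w \<in> euclid n" "norm w \<le> 1" "n > 0"
  obtains g where "g \<in> grid n (n\<^sup>2)" "norm g \<le> 1" "norm (w - g) \<le> 1 / real n"
proof -
  obtain g where g: "g \<in> grid n (n\<^sup>2)" "norm g \<le> norm w" "norm (w - g) \<le> sqrt (real n) / real (n\<^sup>2)"
    using grid_approx[of w n "n\<^sup>2"] assms by auto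
  have "sqrt (real n) \<le> real n" using assms by (intro real_le_lsqrt) (auto simp: power2_eq_square)
  then have "sqrt (real n) / real (n\<^sup>2) \<le> 1 / real n"
    using assms by (simp add: field_simps power2_eq_square)
  with g assms that show thesis by fastforce
qed

text \<open>
  What matters is that the logarithm of the number of grid points is polynomial in \<open>n\<close>.
\<close>

lemma card_grid_square_le: "card (grid n (n\<^sup>2)) \<le> 2 ^ (2 * n\<^sup>2)"
proof -
  show ?thesis
  proof (cases "n = 0")
    case False
    have *: "2 * k\<^sup>2 + 1 \<le> 4 ^ k" if "k > 0" for k :: nat
      using that
    proof (induction k rule: nat_induct_non_zero)
      case (Suc k)
      have "2 * (Suc k)\<^sup>2 + 1 \<le> 4 * (2 * k\<^sup>2 + 1)"
      proof -
        obtain q where q: "q = k * k" by simp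
        then have "k \<le> q" using le_square[of k] by simp
        then show ?thesis unfolding power2_eq_square mult_Suc mult_Suc_right q[symmetric] by presburger
      qed
      with Suc show ?case by simp
    qed simp
    have "card (grid n (n\<^sup>2)) \<le> (2 * n\<^sup>2 + 1) ^ n" by (rule card_grid_le)
    also have "\<dots> \<le> (4 ^ n) ^ n" using * False by (intro power_mono) auto
    also have "\<dots> = (2 ^ 2) ^ (n * n)" by (simp add: power_mult)
    also have "\<dots> = 2 ^ (2 * n\<^sup>2)" by (simp only: power_mult[symmetric]) (simp add: power2_eq_square)
    finally show ?thesis .
  qed (simp add: card_grid_le[of 0 0, simplified])
qed

section \<open>Spread out codes that are sparse in every cap\<close>

definition e\<^sub>0 :: fsvec where "e\<^sub>0 = fsv 1 (\<lambda>_. 1)"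

lemma e0: "norm e\<^sub>0 = 1" "n > 0 \<Longrightarrow> e\<^sub>0 \<in> euclid n"
  by (simp_all add: e\<^sub>0_def norm_euclid[OF fsv_euclid] coord_fsv euclid_def)

text \<open>
  A direction for the origin too, as the origin is a possible outcome of the choice.
\<close>

definition direction :: "fsvec \<Rightarrow> fsvec" where
  "direction x = (if x = 0 then e\<^sub>0 else x /\<^sub>R norm x)"

lemma direction_sphere: "n > 0 \<Longrightarrow> x \<in> euclid n \<Longrightarrow> direction x \<in> unit_sphere n"
  by (auto simp: direction_def unit_sphere_def e0 subspace_scale subspace_euclid)

text \<open>
  The inner products say that angles between the vectors are less than \<open>2\<pi>/3\<close> and that the caps have
  angular radius \<open>\<pi>/3\<close>. The vectors are counted by index, so that repetitions do no harm.
\<close>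

locale spread_code =
  fixes n N K :: nat and v :: "nat \<Rightarrow> fsvec"
  assumes unit: "i < N \<Longrightarrow> v i \<in> unit_sphere n"
    and spread: "i < N \<Longrightarrow> j < N \<Longrightarrow> i \<noteq> j \<Longrightarrow> inner (v i) (v j) > - 1 / 2"
    and sparse: "u \<in> euclid n \<Longrightarrow> norm u \<le> 1 \<Longrightarrow> card {i. i < N \<and> inner u (v i) \<ge> 1 / 2} \<le> K"

text \<open>
  The greedy choice is applied to the uniform distribution on the unit ball, with the caps about the grid
  points as the sets to be hit rarely. The set forbidden by a point is the cap opposite to it, and the
  condition on \<open>N\<close> is that \<open>N\<close> times the bound on the volume of a cap is at most half of the ball.
\<close>

lemma spread_code_exists:
  fixes n N :: nat
  defines "t \<equiv> 1 / 2 - 1 / real n"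
  assumes n: "n \<ge> 2" and N: "2 * real N * sqrt (1 - t\<^sup>2) ^ n \<le> 1"
  shows "\<exists>v. spread_code n N (2 * n\<^sup>2 + 2) v"
proof -
  interpret prob_space "unif n" by (rule prob_space_unif)
  define p where "p = sqrt (1 - t\<^sup>2) ^ n"
  define U where "U = {g \<in> grid n (n\<^sup>2). norm g \<le> 1}"
  have t: "0 \<le> t" "t \<le> 1 / 2" using n by (auto simp: t_def field_simps)
  then have "t\<^sup>2 \<le> (1 / 2)\<^sup>2" by (intro power_mono)
  then have t2: "t\<^sup>2 \<le> 1 / 2" by (simp add: power2_eq_square)
  then have p: "p > 0" by (simp add: p_def)
  have 0: "0 \<in> euclid n" by (rule subspace_0[OF subspace_euclid])
  have U: "finite U" "U \<noteq> {}"
    using grid_approx_square[OF 0] n by (auto simp: U_def) 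
  have prob_cap: "prob (cap n t u) \<le> p" if "u \<in> euclid n" "norm u \<le> 1" for u
    unfolding p_def using that t(1) t2 by (rule prob_cap_le)
  have dir: "direction (fsv n f) \<in> unit_sphere n" for f
    using n by (intro direction_sphere) auto
  let ?D = "\<lambda>f. cap n t (- direction (fsv n f))"
  have "\<exists>x. (\<forall>i<N. x i \<in> space (unif n)) \<and> (\<forall>j<N. \<forall>i<j. x j \<notin> ?D (x i)) \<and>
      (\<Sum>u\<in>U. 2 ^ card {i. i < N \<and> x i \<in> cap n t u}) \<le> real (card U) * (1 + 2 * p) ^ N"
  proof (rule greedy_avoid_and_balance)
    show "prob (?D x) \<le> p" for x
      using dir[of x] by (intro prob_cap) (auto simp: unit_sphere_def subspace_neg subspace_euclid)
    show "prob (cap n t u) \<le> p" if "u \<in> U" for u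
      using that by (intro prob_cap) (auto simp: U_def dest: grid_euclid)
  qed (use U p N in \<open>auto simp: p_def\<close>)
  then obtain x where x: "\<And>i. i < N \<Longrightarrow> x i \<in> space (leb n)"
    "\<And>i j. j < N \<Longrightarrow> i < j \<Longrightarrow> x j \<notin> ?D (x i)"
    and sum: "(\<Sum>u\<in>U. 2 ^ card {i. i < N \<and> x i \<in> cap n t u}) \<le> real (card U) * (1 + 2 * p) ^ N"
    by (auto simp: unif_def)
  define v where "v i = direction (fsv n (x i))" for i
  have v: "v i \<in> unit_sphere n" for i using dir by (simp add: v_def)
  have less: "inner (v i) (v j) > - 1 / 2" if "i < j" "j < N" for i j
  proof -
    \<comment> \<open>The origin lies in every cap, so the later points are nonzero.\<close>
    have *: "- inner (v i) (fsv n (x j)) < t * norm (fsv n (x j))"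
      using x(2)[OF that(2,1)] x(1)[OF that(2)] by (simp add: cap_def v_def not_le)
    then have "fsv n (x j) \<noteq> 0" by auto
    then have "v j = fsv n (x j) /\<^sub>R norm (fsv n (x j))" "norm (fsv n (x j)) > 0"
      by (auto simp: v_def direction_def)
    with * have "- inner (v i) (v j) < t" by (simp add: field_simps)
    with t show ?thesis by simp
  qed
  have count: "card {i. i < N \<and> inner u (v i) \<ge> 1 / 2} \<le> 2 * n\<^sup>2 + 2"
    if u: "u \<in> euclid n" "norm u \<le> 1" for u
  proof -
    \<comment> \<open>The cap of height \<open>1/2\<close> about \<open>u\<close> lies in the cap of height \<open>t = 1/2 - 1/n\<close> about \<open>g\<close>.\<close>
    obtain g where g: "g \<in> grid n (n\<^sup>2)" "norm g \<le> 1" "norm (u - g) \<le> 1 / real n"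
      using grid_approx_square[OF u] n by auto
    then have gU: "g \<in> U" by (simp add: U_def)
    have "x i \<in> cap n t g" if "i < N" "inner u (v i) \<ge> 1 / 2" for i
    proof (cases "fsv n (x i) = 0")
      case True
      with x that show ?thesis by (simp add: cap_def)
    next
      case False
      have "inner (u - g) (v i) \<le> norm (u - g) * norm (v i)" by (rule norm_cauchy_schwarz)
      also have "\<dots> \<le> 1 / real n" using g v[of i] by (simp add: unit_sphere_def)
      finally have "inner g (v i) \<ge> t" using that by (simp add: t_def inner_diff_left)
      with False x that show ?thesis by (simp add: cap_def v_def direction_def field_simps)
    qed
    then have "card {i. i < N \<and> inner u (v i) \<ge> 1 / 2} \<le> card {i. i < N \<and> x i \<in> cap n t g}"
      by (intro card_mono) auto
    then have "(2::real) ^ card {i. i < N \<and> inner u (v i) \<ge> 1 / 2} \<le> 2 ^ card {i. i < N \<and> x i \<in> cap n t g}"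
      by (intro power_increasing) auto
    also have "\<dots> \<le> (\<Sum>u\<in>U. 2 ^ card {i. i < N \<and> x i \<in> cap n t u})"
      using U(1) gU by (intro member_le_sum) auto
    also have "\<dots> \<le> real (card U) * (1 + 2 * p) ^ N" by (rule sum)
    also have "\<dots> \<le> 2 ^ (2 * n\<^sup>2) * 4"
    proof (rule mult_mono)
      have "card U \<le> card (grid n (n\<^sup>2))" unfolding U_def by (intro card_mono) auto
      also have "\<dots> \<le> 2 ^ (2 * n\<^sup>2)" by (rule card_grid_square_le)
      finally have "real (card U) \<le> real (2 ^ (2 * n\<^sup>2))" by (simp only: of_nat_le_iff)
      then show "real (card U) \<le> 2 ^ (2 * n\<^sup>2)" by simp
      have "(1 + 2 * p) ^ N \<le> exp (2 * p) ^ N" using p by (intro power_mono) auto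
      also have "\<dots> = exp (2 * real N * p)" by (simp add: exp_of_nat_mult[symmetric] algebra_simps)
      also have "\<dots> \<le> exp 1" using N by (simp add: p_def)
      also have "\<dots> \<le> 4" using exp_le by simp
      finally show "(1 + 2 * p) ^ N \<le> 4" .
    qed (use p in auto)
    also have "\<dots> = 2 ^ (2 * n\<^sup>2 + 2)" by simp
    finally show ?thesis by (simp only: power_increasing_iff)
  qed
  have "spread_code n N (2 * n\<^sup>2 + 2) v"
  proof
    fix i j assume "i < N" "j < N" "i \<noteq> j"
    then show "inner (v i) (v j) > - 1 / 2"
      using less[of i j] less[of j i] by (cases "i < j") (auto simp: inner_commute)
  qed (use v count in auto)
  then show ?thesis by blast
qed

section \<open>Piercing pairwise intersecting balls\<close>

lemma sgn_euclid: "x \<in> euclid n \<Longrightarrow> sgn x \<in> euclid n"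
  by (simp add: sgn_div_norm subspace_scale subspace_euclid)

text \<open>
  Move from the point \<open>y\<close> of the ball towards its centre by \<open>s\<close>, or up to the centre if that is
  nearer: the ball of radius \<open>s\<close> about the new point is contained in the given one.
\<close>

lemma ball_contains_smaller_ball:
  fixes c y :: "'a :: real_normed_vector"
  assumes "norm (c - y) \<le> r" "0 < s" "s \<le> r"
  obtains l where "norm (l *\<^sub>R (c - y)) \<le> s" "norm (c - (y + l *\<^sub>R (c - y))) \<le> r - s"
proof (cases "norm (c - y) \<le> s")
  case True
  with assms show thesis by (intro that[of 1]) auto
next
  case False
  define l where "l = s / norm (c - y)"
  have l: "0 \<le> l" "l \<le> 1" and ls: "l * norm (c - y) = s"
    using False assms by (auto simp: l_def divide_le_eq)
  have "c - (y + l *\<^sub>R (c - y)) = (1 - l) *\<^sub>R (c - y)" by (simp add: algebra_simps)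
  then have "norm (c - (y + l *\<^sub>R (c - y))) = norm (c - y) - s"
    using l ls by (simp add: left_diff_distrib)
  with assms l ls show thesis by (intro that[of l]) auto
qed

text \<open>
  A ball of radius at least \<open>s\<close> that comes within \<open>2 s\<close> of \<open>a\<close> contains a ball of radius exactly \<open>s\<close>
  whose centre is within \<open>3 s\<close> of \<open>a\<close>. The grid, scaled by \<open>3 s\<close> and centred at \<open>a\<close>, has
  mesh \<open>3 s / n < s\<close> and meets its interior. The strict inequality is needed for illumination, where open
  cones have to be hit.
\<close>

lemma grid_hits_touching_ball:
  assumes n: "n \<ge> 4" and E: "a \<in> euclid n" "y \<in> euclid n" "c \<in> euclid n"
    and s: "0 < s" "s \<le> r" and y: "norm (y - a) \<le> 2 * s" "norm (c - y) \<le> r"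
  obtains g where "g \<in> grid n (n\<^sup>2)" "norm (a + (3 * s) *\<^sub>R g - c) < r"
proof -
  obtain l where l: "norm (l *\<^sub>R (c - y)) \<le> s" "norm (c - (y + l *\<^sub>R (c - y))) \<le> r - s"
    using ball_contains_smaller_ball[OF y(2) s] .
  define c' where "c' = y + l *\<^sub>R (c - y)"
  have c': "c' \<in> euclid n"
    unfolding c'_def using E by (intro subspace_add subspace_scale subspace_diff subspace_euclid)
  have "norm (c' - a) \<le> norm (y - a) + norm (l *\<^sub>R (c - y))"
    unfolding c'_def using norm_triangle_ineq[of "y - a" "l *\<^sub>R (c - y)"] by (simp add: algebra_simps)
  then have c'a: "norm (c' - a) \<le> 3 * s" using y l by simp
  define h where "h = (1 / (3 * s)) *\<^sub>R (c' - a)"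
  have h: "h \<in> euclid n" "norm h \<le> 1"
    using c' E c'a s by (auto simp: h_def intro!: subspace_scale subspace_diff subspace_euclid)
  obtain g where g: "g \<in> grid n (n\<^sup>2)" "norm (h - g) \<le> 1 / real n"
    using grid_approx_square[OF h] n by auto
  have "a + (3 * s) *\<^sub>R g - c' = - ((3 * s) *\<^sub>R (h - g))"
    using s by (simp add: h_def algebra_simps)
  then have "norm (a + (3 * s) *\<^sub>R g - c') = 3 * s * norm (h - g)"
    using s by simp
  also have "\<dots> \<le> 3 * s * (1 / 4)"
    using g(2) n s by (intro mult_left_mono order.trans[OF g(2)]) (auto simp: field_simps)
  also have "\<dots> < s" using s by simp
  finally have "norm (a + (3 * s) *\<^sub>R g - c') < s" .
  moreover have "norm (c' - c) \<le> r - s" using l(2) by (simp add: c'_def norm_minus_commute)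
  ultimately have "norm (a + (3 * s) *\<^sub>R g - c) < r"
    using norm_triangle_ineq[of "a + (3 * s) *\<^sub>R g - c'" "c' - c"] by simp
  with g(1) show thesis by (rule that)
qed

text \<open>
  Every ball meets the smallest one, so the grid scaled to the smallest ball pierces all of
  them. Hence the set whose least element is \<open>G n\<close> is not empty.
\<close>

lemma pairwise_intersecting_balls_pierced:
  assumes n: "n \<ge> 4" and F: "finite F" "\<forall>B\<in>F. closed_ball n B" "pairwise (\<lambda>A B. A \<inter> B \<noteq> {}) F"
  shows "\<exists>P\<subseteq>euclid n. finite P \<and> card P = card (grid n (n\<^sup>2)) \<and> pierces P F"
proof (cases "F = {}")
  case True
  then show ?thesis by (intro exI[of _ "grid n (n\<^sup>2)"]) (auto simp: pierces_def grid_euclid)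
next
  case False
  have "\<forall>B\<in>F. \<exists>c r. c \<in> euclid n \<and> r > 0 \<and> B = cball c r \<inter> euclid n"
    using F(2) unfolding closed_ball_def by blast
  then obtain c r where cr: "\<And>B. B \<in> F \<Longrightarrow> c B \<in> euclid n" "\<And>B. B \<in> F \<Longrightarrow> r B > (0::real)"
    "\<And>B. B \<in> F \<Longrightarrow> B = cball (c B) (r B) \<inter> euclid n"
    by metis
  obtain A where A: "A \<in> F" "\<And>B. B \<in> F \<Longrightarrow> r A \<le> r B"
    using obtains_MIN[OF F(1) False, of r] F(1) by (metis (no_types, lifting) Min_le finite_imageI image_eqI)
  define f where "f g = c A + (3 * r A) *\<^sub>R g" for g
  have inj: "inj_on f (grid n (n\<^sup>2))"
    using cr(2)[OF A(1)] by (auto simp: inj_on_def f_def)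
  have "f ` grid n (n\<^sup>2) \<inter> B \<noteq> {}" if B: "B \<in> F" for B
  proof -
    have "A \<inter> B \<noteq> {}"
    proof (cases "A = B")
      case True
      have "c A \<in> A" using cr(1,2)[OF A(1)] by (subst cr(3)[OF A(1)]) auto
      with True show ?thesis by auto
    qed (use F(3) A(1) B in \<open>auto simp: pairwise_def\<close>)
    then obtain y where "y \<in> A" "y \<in> B" by blast
    then have y: "y \<in> euclid n" "norm (y - c A) \<le> r A" "norm (c B - y) \<le> r B"
      using cr(3)[OF A(1)] cr(3)[OF B] by (auto simp: dist_norm norm_minus_commute)
    have "norm (y - c A) \<le> 2 * r A" using y(2) cr(2)[OF A(1)] by simp
    with grid_hits_touching_ball[OF n cr(1)[OF A(1)] y(1) cr(1)[OF B] cr(2)[OF A(1)] A(2)[OF B] _ y(3)]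
    obtain g where g: "g \<in> grid n (n\<^sup>2)" "norm (f g - c B) < r B"
      by (auto simp: f_def)
    have "f g \<in> euclid n"
      unfolding f_def using cr(1)[OF A(1)] grid_euclid[OF g(1)]
      by (intro subspace_add subspace_scale subspace_euclid)
    with g(2) have "f g \<in> B" by (subst cr(3)[OF B]) (auto simp: dist_norm norm_minus_commute)
    with g(1) show ?thesis by blast
  qed
  then have "pierces (f ` grid n (n\<^sup>2)) F" by (simp add: pierces_def)
  moreover have "f ` grid n (n\<^sup>2) \<subseteq> euclid n"
    unfolding f_def using cr(1)[OF A(1)] grid_euclid
    by (auto intro!: subspace_add subspace_scale subspace_euclid)
  ultimately show ?thesis
    using inj by (intro exI[of _ "f ` grid n (n\<^sup>2)"]) (auto simp: card_image)
qed

lemma G_pierces: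
  assumes n: "n \<ge> 4" and F: "finite F" "\<forall>B\<in>F. closed_ball n B" "pairwise (\<lambda>A B. A \<inter> B \<noteq> {}) F"
  obtains P where "P \<subseteq> euclid n" "finite P" "card P = G n" "pierces P F"
proof -
  have "\<forall>F. finite F \<and> (\<forall>B\<in>F. closed_ball n B) \<and> pairwise (\<lambda>A B. A \<inter> B \<noteq> {}) F
            \<longrightarrow> (\<exists>P\<subseteq>euclid n. finite P \<and> card P = G n \<and> pierces P F)"
    unfolding G_def
    by (rule LeastI[of _ "card (grid n (n\<^sup>2))"]) (use pairwise_intersecting_balls_pierced[OF n] in blast)
  with F that show thesis by blast
qed

section \<open>Caps needed to cover a code\<close>

context spread_code
begin

lemma v: "i < N \<Longrightarrow> v i \<in> euclid n" "i < N \<Longrightarrow> norm (v i) = 1"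
  using unit[of i] by (auto simp: unit_sphere_def)

lemma caps_needed:
  assumes Q: "finite Q" "Q \<subseteq> euclid n" "\<And>u. u \<in> Q \<Longrightarrow> norm u \<le> 1"
    and cover: "\<And>i. i < N \<Longrightarrow> \<exists>u\<in>Q. inner u (v i) \<ge> 1 / 2"
  shows "N \<le> card Q * K"
proof -
  have "card {..<N} \<le> card (\<Union>u\<in>Q. {i. i < N \<and> inner u (v i) \<ge> 1 / 2})"
    using cover Q(1) by (intro card_mono) auto
  also have "\<dots> \<le> (\<Sum>u\<in>Q. card {i. i < N \<and> inner u (v i) \<ge> 1 / 2})"
    using Q(1) by (rule card_UN_le)
  also have "\<dots> \<le> (\<Sum>u\<in>Q. K)" using Q sparse by (intro sum_mono) auto
  finally show ?thesis by simp
qed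

lemma dist_v:
  assumes "i < N" "j < N" "i \<noteq> j"
  shows "norm (v i - v j) < sqrt 3"
proof -
  have "(norm (v i - v j))\<^sup>2 = 2 - 2 * inner (v i) (v j)"
    using v[OF assms(1)] v[OF assms(2)] unfolding power2_norm_eq_inner
    by (simp add: inner_diff inner_commute norm_eq_1)
  also have "\<dots> < 3" using spread[OF assms] by simp
  finally show ?thesis by (rule real_less_rsqrt)
qed

text \<open>
  If a point \<open>q\<close> pierces the ball about \<open>v i\<close>, then \<open>2 (q \<bullet> v i) \<ge> norm q ^ 2 + 1/4 \<ge> norm q\<close>
  by the inequality of the means. So \<open>v i\<close> lies in the cap about the direction of \<open>q\<close>, and the
  directions of the piercing points are the centres of a covering by caps.
\<close>

lemma le_G:
  assumes n: "n \<ge> 4"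
  shows "N \<le> G n * K"
proof -
  define B where "B i = cball (v i) (sqrt 3 / 2) \<inter> euclid n" for i
  have "B i \<inter> B j \<noteq> {}" if "i < N" "j < N" "i \<noteq> j" for i j
  proof -
    let ?m = "(1 / 2) *\<^sub>R (v i + v j)"
    have "v i - ?m = (1 / 2) *\<^sub>R (v i - v j)" "v j - ?m = (1 / 2) *\<^sub>R (v j - v i)"
      using scaleR_half_double[of "v i"] scaleR_half_double[of "v j"] by (simp_all add: algebra_simps)
    then have "norm (v i - ?m) \<le> sqrt 3 / 2" "norm (v j - ?m) \<le> sqrt 3 / 2"
      using dist_v[OF that] dist_v[of j i] that by simp_all
    moreover have "?m \<in> euclid n"
      using v that by (intro subspace_add subspace_scale subspace_euclid)
    ultimately show ?thesis by (auto simp: B_def dist_norm)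
  qed
  then have "pairwise (\<lambda>A B. A \<inter> B \<noteq> {}) (B ` {..<N})"
    by (auto simp: pairwise_def)
  moreover have "\<forall>A\<in>B ` {..<N}. closed_ball n A"
    using v by (auto simp: closed_ball_def B_def intro!: bexI exI[of _ "sqrt 3 / 2"])
  ultimately obtain P where P: "P \<subseteq> euclid n" "finite P" "card P = G n" "pierces P (B ` {..<N})"
    using G_pierces[OF n, of "B ` {..<N}"] by auto
  have "N \<le> card (sgn ` P) * K"
  proof (rule caps_needed)
    fix i assume i: "i < N"
    then obtain q where q: "q \<in> P" "norm (v i - q) \<le> sqrt 3 / 2"
      using P(4) by (fastforce simp: pierces_def B_def dist_norm)
    have "1 + (norm q)\<^sup>2 - 2 * inner q (v i) = (norm (v i - q))\<^sup>2"
      using v(2)[OF i] unfolding power2_norm_eq_inner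
      by (simp add: inner_diff inner_commute norm_eq_1)
    also have "\<dots> \<le> (sqrt 3 / 2)\<^sup>2" using q(2) by (intro power_mono) auto
    also have "\<dots> = 3 / 4" by (simp add: power_divide)
    finally have le: "1 / 4 + (norm q)\<^sup>2 \<le> 2 * inner q (v i)" by simp
    moreover have "0 \<le> (norm q - 1 / 2)\<^sup>2" by simp
    ultimately have "norm q \<le> 2 * inner q (v i)" by (simp add: power2_eq_square algebra_simps)
    moreover have "q \<noteq> 0" using le by auto
    ultimately have "1 / 2 \<le> inner (sgn q) (v i)" by (simp add: sgn_div_norm field_simps)
    with q(1) show "\<exists>u\<in>sgn ` P. 1 / 2 \<le> inner u (v i)" by blast
  qed (use P in \<open>auto simp: norm_sgn intro!: sgn_euclid\<close>)
  also have "\<dots> \<le> G n * K" using P(2,3) card_image_le[of P sgn] by simp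
  finally show ?thesis .
qed

end

section \<open>Spikes and illumination\<close>

lemma interior_of_euclid_top:
  "y \<in> euclid_top n interior_of S \<longleftrightarrow> y \<in> euclid n \<and> (\<exists>e>0. ball y e \<inter> euclid n \<subseteq> S)" (is "_ \<longleftrightarrow> ?R")
proof
  assume "y \<in> euclid_top n interior_of S"
  then obtain T where T: "openin (euclid_top n) T" "y \<in> T" "T \<subseteq> S"
    by (auto simp: interior_of_def)
  then show ?R unfolding openin_contains_ball by blast
next
  assume ?R
  then obtain e where e: "y \<in> euclid n" "e > 0" "ball y e \<inter> euclid n \<subseteq> S" by blast
  have "openin (euclid_top n) (ball y e \<inter> euclid n)"
    by (auto simp: openin_open)
  with e show "y \<in> euclid_top n interior_of S"
    unfolding interior_of_def by (intro CollectI exI[of _ "ball y e \<inter> euclid n"]) auto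
qed

abbreviation spike :: "nat \<Rightarrow> fsvec \<Rightarrow> fsvec set" where
  "spike n x \<equiv> convex hull (unit_ball n \<union> {x})"

lemma convex_unit_ball: "convex (unit_ball n)"
  unfolding unit_ball_def by (intro convex_Int convex_cball subspace_imp_convex subspace_euclid)

lemma zero_unit_ball: "0 \<in> unit_ball n"
  by (simp add: unit_ball_def subspace_0 subspace_euclid)

text \<open>
  The spike is the union of the balls of radius \<open>l\<close> about the points \<open>(1 - l) x\<close>, as the ball
  shrinks from the unit ball to the vertex. This description makes closedness a matter of compactness of
  \<open>{0..1}\<close> only, and interior points easy to recognise.
\<close>

lemma in_spike_iff:
  assumes x: "x \<in> euclid n"
  shows "y \<in> spike n x \<longleftrightarrow> y \<in> euclid n \<and> (\<exists>l\<in>{0..1}. norm (y - (1 - l) *\<^sub>R x) \<le> l)"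
    (is "_ \<longleftrightarrow> ?R")
proof -
  have "spike n x = {y. \<exists>u\<ge>0. \<exists>l\<ge>0. \<exists>b. u + l = 1 \<and> b \<in> unit_ball n \<and> y = u *\<^sub>R x + l *\<^sub>R b}"
    using zero_unit_ball[of n]
    by (subst Un_commute, subst insert_is_Un[symmetric], subst convex_hull_insert)
       (auto simp: convex_hull_eq[THEN iffD2, OF convex_unit_ball])
  then have iff: "y \<in> spike n x \<longleftrightarrow>
      (\<exists>u\<ge>0. \<exists>l\<ge>0. \<exists>b. u + l = 1 \<and> b \<in> unit_ball n \<and> y = u *\<^sub>R x + l *\<^sub>R b)"
    by simp
  show ?thesis
  proof
    assume "y \<in> spike n x"
    then obtain u l b where ulb: "u \<ge> 0" "l \<ge> 0" "u + l = 1" "b \<in> unit_ball n" "y = u *\<^sub>R x + l *\<^sub>R b"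
      using iff by blast
    have "u = 1 - l" using ulb by simp
    then have "norm (y - (1 - l) *\<^sub>R x) = l * norm b" unfolding ulb(5) using ulb(2) by simp
    also have "\<dots> \<le> l" using ulb by (simp add: unit_ball_def mult_left_le)
    finally have "norm (y - (1 - l) *\<^sub>R x) \<le> l" .
    moreover have "y \<in> euclid n"
      using ulb x by (auto simp: unit_ball_def intro!: subspace_add subspace_scale subspace_euclid)
    ultimately show ?R using ulb by auto
  next
    assume ?R
    then obtain l where l: "y \<in> euclid n" "0 \<le> l" "l \<le> 1" "norm (y - (1 - l) *\<^sub>R x) \<le> l" by auto
    define b where "b = (1 / l) *\<^sub>R (y - (1 - l) *\<^sub>R x)"
    have "b \<in> unit_ball n"
      using l x by (cases "l = 0")
        (auto simp: b_def unit_ball_def divide_le_eq intro!: subspace_0 subspace_scale subspace_diff subspace_euclid)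
    moreover have "y = (1 - l) *\<^sub>R x + l *\<^sub>R b"
      using l by (cases "l = 0") (auto simp: b_def)
    ultimately show "y \<in> spike n x" using l unfolding iff by (intro exI[of _ "1 - l"]) auto
  qed
qed

text \<open>
  A point outside the spike is outside all the balls of radius \<open>l\<close> about \<open>(1 - l) x\<close>, and by
  compactness of the parameter interval its distance to them is bounded below by a positive number.
\<close>

lemma closedin_spike:
  assumes x: "x \<in> euclid n"
  shows "closedin (euclid_top n) (spike n x)"
  unfolding closedin_def openin_contains_ball
proof (intro conjI ballI)
  show "spike n x \<subseteq> topspace (euclid_top n)" using in_spike_iff[OF x] by auto
next
  fix z assume z: "z \<in> topspace (euclid_top n) - spike n x"
  define f where "f l = norm (z - (1 - l) *\<^sub>R x) - l" for l
  have "continuous_on {0..1} f" unfolding f_def by (intro continuous_intros)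
  then obtain l0 where l0: "l0 \<in> {0..1}" "\<And>l. l \<in> {0..1} \<Longrightarrow> f l0 \<le> f l"
    using continuous_attains_inf[of "{0..1::real}" f] by auto
  have "f l0 > 0" using z l0(1) in_spike_iff[OF x, of z] by (force simp: f_def)
  moreover have "ball z (f l0) \<inter> euclid n \<subseteq> topspace (euclid_top n) - spike n x"
  proof
    fix y assume y: "y \<in> ball z (f l0) \<inter> euclid n"
    have "norm (y - (1 - l) *\<^sub>R x) > l" if "l \<in> {0..1}" for l
    proof -
      have "norm (z - (1 - l) *\<^sub>R x) \<le> norm (z - y) + norm (y - (1 - l) *\<^sub>R x)"
        using norm_triangle_ineq[of "z - y" "y - (1 - l) *\<^sub>R x"] by simp
      moreover have "norm (z - y) < f l" using y l0(2)[OF that] by (auto simp: dist_norm)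
      ultimately show ?thesis by (simp add: f_def)
    qed
    then show "y \<in> topspace (euclid_top n) - spike n x"
      using y in_spike_iff[OF x, of y] by force
  qed
  ultimately show "\<exists>e>0. ball z e \<inter> euclid n \<subseteq> topspace (euclid_top n) - spike n x" by blast
qed auto

lemma closedin_spiky:
  assumes "finite X" "X \<subseteq> euclid n"
  shows "closedin (euclid_top n) (spiky n X)"
  unfolding spiky_def using assms closedin_spike by (intro closedin_Union) auto

lemma frontier_spiky_subset:
  assumes "finite X" "X \<subseteq> euclid n"
  shows "euclid_top n frontier_of spiky n X \<subseteq> spiky n X"
  using closedin_spiky[OF assms] by (rule frontier_of_subset_closedin)

lemma unit_ball_subset_spike: "unit_ball n \<subseteq> spike n x"
  using hull_subset[of "unit_ball n \<union> {x}" convex] by simp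

lemma unit_ball_subset_spiky: "X \<noteq> {} \<Longrightarrow> unit_ball n \<subseteq> spiky n X"
  unfolding spiky_def using unit_ball_subset_spike by blast

lemma open_ball_interior_spiky:
  assumes "X \<noteq> {}" "y \<in> euclid n" "norm y < 1"
  shows "y \<in> euclid_top n interior_of spiky n X"
proof -
  have "norm z \<le> 1" if "dist y z < 1 - norm y" for z
    using that norm_triangle_ineq2[of z y] by (simp add: dist_norm norm_minus_commute)
  then have "ball y (1 - norm y) \<inter> euclid n \<subseteq> unit_ball n"
    by (auto simp: unit_ball_def)
  with assms unit_ball_subset_spiky show ?thesis
    unfolding interior_of_euclid_top by (intro conjI exI[of _ "1 - norm y"]) auto
qed

text \<open>
  If the ray from the vertex \<open>x\<close> in direction \<open>u\<close> enters the open unit ball, then \<open>u\<close>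
  illuminates not only \<open>x\<close> but every frontier point of its spike that is not just a point of the
  unit ball: such a point is a proper convex combination of \<open>x\<close> and a point of the unit ball, and the cone of
  interior points at \<open>x\<close> is carried to it by the homothety.
\<close>

lemma illuminates_spike_point:
  assumes X: "X \<subseteq> euclid n" "x \<in> X"
    and y: "y \<in> euclid_top n frontier_of spiky n X" "y \<in> euclid n"
    and l: "0 \<le> l" "l < 1" "norm (y - (1 - l) *\<^sub>R x) \<le> l"
    and u: "u \<in> unit_sphere n" "t > 0" "norm (x + t *\<^sub>R u) < 1"
  shows "illuminates n (spiky n X) u y"
  unfolding illuminates_def
proof (intro conjI allI impI u(1) y(1))
  fix e :: real assume e: "e > 0"
  define s where "s = min 1 (e / (2 * t))"
  have s: "0 < s" "s \<le> 1" "s * t < e"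
    using e u(2) by (auto simp: s_def min_def field_simps)
  \<comment> \<open>A step of length \<open>s (1 - l) t\<close> leads into the ball with parameter \<open>L\<close>, at depth \<open>d\<close>.\<close>
  define d where "d = s * (1 - l) * (1 - norm (x + t *\<^sub>R u))"
  define L where "L = l + s * (1 - l)"
  have d: "d > 0" using s l u by (simp add: d_def)
  have "s * (1 - l) \<le> 1 - l" using s l mult_right_mono[of s 1 "1 - l"] by simp
  then have L1: "L \<le> 1" unfolding L_def by linarith
  have L0: "0 \<le> L" using s l by (simp add: L_def)
  note L = L0 L1
  let ?y = "y + (s * (1 - l) * t) *\<^sub>R u"
  have y': "?y \<in> euclid n"
    using y(2) u(1) by (auto simp: unit_sphere_def intro!: subspace_add subspace_scale subspace_euclid)
  have "z \<in> spike n x" if z: "dist ?y z < d" "z \<in> euclid n" for z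
  proof -
    have "?y - (1 - L) *\<^sub>R x = (y - (1 - l) *\<^sub>R x) + (s * (1 - l)) *\<^sub>R (x + t *\<^sub>R u)"
      by (simp add: L_def algebra_simps)
    then have "norm (?y - (1 - L) *\<^sub>R x) \<le> norm (y - (1 - l) *\<^sub>R x) + s * (1 - l) * norm (x + t *\<^sub>R u)"
      using s l by (metis abs_of_nonneg diff_ge_0_iff_ge less_imp_le mult_nonneg_nonneg norm_scaleR norm_triangle_ineq)
    also have "\<dots> \<le> L - d" using l by (simp add: L_def d_def algebra_simps)
    finally have "norm (z - (1 - L) *\<^sub>R x) \<le> L"
      using z(1) norm_triangle_ineq[of "z - ?y" "?y - (1 - L) *\<^sub>R x"]
      by (simp add: dist_norm norm_minus_commute)
    with L z(2) show ?thesis using X by (subst in_spike_iff) auto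
  qed
  then have "ball ?y d \<inter> euclid n \<subseteq> spiky n X"
    using X(2) by (auto simp: spiky_def)
  then have "?y \<in> euclid_top n interior_of spiky n X"
    unfolding interior_of_euclid_top using y' d by blast
  moreover have "dist y ?y < e"
  proof -
    have "dist y ?y = s * (1 - l) * t" using u s l by (simp add: dist_norm unit_sphere_def)
    also have "\<dots> \<le> s * 1 * t" using s l u by (intro mult_right_mono mult_left_mono) auto
    finally show ?thesis using s by simp
  qed
  moreover have "s * (1 - l) * t \<ge> 0" using s l u by simp
  ultimately show "\<exists>t\<ge>0. y + t *\<^sub>R u \<in> euclid_top n interior_of spiky n X \<and> dist y (y + t *\<^sub>R u) < e"
    by blast
qed

lemma illuminates_sphere_point:
  assumes X: "X \<noteq> {}"
    and y: "y \<in> euclid_top n frontier_of spiky n X" "y \<in> euclid n" "norm y \<le> 1"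
    and u: "u \<in> unit_sphere n" "inner u y < 0"
  shows "illuminates n (spiky n X) u y"
  unfolding illuminates_def
proof (intro conjI allI impI u(1) y(1))
  fix e :: real assume e: "e > 0"
  define s where "s = min (- inner u y) (e / 2)"
  have s: "0 < s" "s < e" "s \<le> - inner u y" using e u by (auto simp: s_def min_def)
  have "(norm (y + s *\<^sub>R u))\<^sup>2 = (norm y)\<^sup>2 + 2 * s * inner u y + s * s"
    using u(1) unfolding power2_norm_eq_inner
    by (simp add: unit_sphere_def inner_add inner_commute norm_eq_1)
  also have "\<dots> < 1"
  proof -
    have "s * s \<le> s * (- inner u y)" using s by (intro mult_left_mono) auto
    moreover have "s * inner u y < 0" using s u by (simp add: mult_pos_neg)
    moreover have "(norm y)\<^sup>2 \<le> 1" using y by (simp add: abs_square_le_1)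
    ultimately show ?thesis by simp
  qed
  finally have "norm (y + s *\<^sub>R u) < 1" by (simp add: abs_square_less_1)
  moreover have "y + s *\<^sub>R u \<in> euclid n"
    using y u by (auto simp: unit_sphere_def intro!: subspace_add subspace_scale subspace_euclid)
  ultimately have "y + s *\<^sub>R u \<in> euclid_top n interior_of spiky n X"
    using X open_ball_interior_spiky by blast
  moreover have "dist y (y + s *\<^sub>R u) < e" using s u(1) by (simp add: dist_norm unit_sphere_def)
  ultimately show "\<exists>t\<ge>0. y + t *\<^sub>R u \<in> euclid_top n interior_of spiky n X \<and> dist y (y + t *\<^sub>R u) < e"
    using s by (intro exI[of _ s]) auto
qed

lemma spiky_verticesD:
  assumes "spiky_vertices n X"
  shows "finite X" "X \<noteq> {}" "X \<subseteq> euclid n" "x \<in> X \<Longrightarrow> norm x > 1"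
  using assms by (auto simp: spiky_vertices_def unit_ball_def)

text \<open>
  A vertex in another spike would be superfluous, because that spike is convex and hence contains the
  whole spike of the vertex.
\<close>

lemma vertex_not_in_other_spikes:
  assumes X: "spiky_vertices n X" "x \<in> X"
  shows "x \<notin> spiky n (X - {x})"
proof
  assume "x \<in> spiky n (X - {x})"
  then obtain z where z: "z \<in> X - {x}" "x \<in> spike n z" by (auto simp: spiky_def)
  have "spike n x \<subseteq> spike n z"
    using z(2) unit_ball_subset_spike[of n z] by (intro hull_minimal convex_convex_hull) auto
  with z have "spiky n X = spiky n (X - {x})" by (auto simp: spiky_def)
  with X show False by (auto simp: spiky_vertices_def)
qed

text \<open>
  Near the vertex \<open>x\<close> the spiky ball coincides with the spike of \<open>x\<close>, because the other
  spikes are closed and do not contain \<open>x\<close>. A point \<open>x + s u\<close> of that spike is a convex combination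
  of \<open>x\<close> and a point of the unit ball, which is then on the ray.
\<close>

lemma illuminated_vertex_ray_meets_ball:
  assumes X: "spiky_vertices n X" "x \<in> X" and ill: "illuminates n (spiky n X) u x"
  obtains t where "t > 0" "norm (x + t *\<^sub>R u) \<le> 1"
proof -
  note XD = spiky_verticesD[OF X(1)]
  have xE: "x \<in> euclid n" using X XD by blast
  have "closedin (euclid_top n) (spiky n (X - {x}))" using XD by (intro closedin_spiky) auto
  then have "openin (euclid_top n) (euclid n - spiky n (X - {x}))" by (simp add: closedin_def)
  with xE vertex_not_in_other_spikes[OF X]
  obtain e where e: "e > 0" "ball x e \<inter> euclid n \<subseteq> euclid n - spiky n (X - {x})"
    unfolding openin_contains_ball by blast
  obtain s where s: "s \<ge> 0" "x + s *\<^sub>R u \<in> euclid_top n interior_of spiky n X" "dist x (x + s *\<^sub>R u) < e"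
    using ill e(1) unfolding illuminates_def by blast
  have "x \<notin> euclid_top n interior_of spiky n X"
    using ill by (auto simp: illuminates_def frontier_of_def)
  with s have "s \<noteq> 0" by auto
  with s have s0: "s > 0" by simp
  have "x + s *\<^sub>R u \<in> spiky n X" "x + s *\<^sub>R u \<in> euclid n"
    using s(2) interior_of_subset[of "euclid_top n" "spiky n X"] by (auto simp: interior_of_euclid_top)
  moreover from this s(3) e(2) have "x + s *\<^sub>R u \<notin> spiky n (X - {x})" by auto
  ultimately have "x + s *\<^sub>R u \<in> spike n x" by (auto simp: spiky_def)
  then obtain l where l: "0 \<le> l" "l \<le> 1" "norm (x + s *\<^sub>R u - (1 - l) *\<^sub>R x) \<le> l"
    using in_spike_iff[OF xE] by auto
  have eq: "x + s *\<^sub>R u - (1 - l) *\<^sub>R x = l *\<^sub>R x + s *\<^sub>R u" by (simp add: algebra_simps)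
  have "norm u = 1" using ill by (simp add: illuminates_def unit_sphere_def)
  with l s0 eq have "l \<noteq> 0" by auto
  with l have l0: "l > 0" by simp
  have "l *\<^sub>R (x + (s / l) *\<^sub>R u) = l *\<^sub>R x + s *\<^sub>R u" using l0 by (simp add: algebra_simps)
  with l eq have "norm (l *\<^sub>R (x + (s / l) *\<^sub>R u)) \<le> l" by simp
  with l0 have "norm (x + (s / l) *\<^sub>R u) \<le> 1" by simp
  with s0 l0 show thesis by (intro that[of "s / l"]) auto
qed

section \<open>Bounded illumination numbers\<close>

text \<open>
  The foot of the perpendicular from the origin to the ray has distance \<open>a \<le> norm x\<close> from \<open>x\<close>.
  The half angle of the cone of rays that meet the ball is \<open>arcsin (1 / norm x)\<close>, and the last
  inequality says that \<open>u\<close> deviates from the axis by a corresponding amount.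
\<close>

lemma ray_closest_point:
  fixes x u :: "'a :: real_inner"
  assumes u: "norm u = 1" and t: "t > 0" "norm (x + t *\<^sub>R u) \<le> 1" and x: "norm x > 1"
  obtains a where "0 < a" "a \<le> norm x" "norm (x + a *\<^sub>R u) \<le> 1" "norm (u + x /\<^sub>R norm x) \<le> 2 / norm x"
proof -
  define a where "a = - inner u x"
  have exp: "(norm (x + s *\<^sub>R u))\<^sup>2 = (norm x)\<^sup>2 - 2 * s * a + s\<^sup>2" for s
    using u unfolding power2_norm_eq_inner
    by (simp add: a_def inner_add inner_commute norm_eq_1 power2_eq_square)
  have sq: "(norm x)\<^sup>2 > 1" using x by (simp add: one_less_power)
  have "(norm (x + t *\<^sub>R u))\<^sup>2 \<le> 1" using t by (simp add: abs_square_le_1)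
  then have tle: "(norm x)\<^sup>2 - 2 * t * a + t\<^sup>2 \<le> 1" by (simp add: exp)
  have "0 \<le> t\<^sup>2" by simp
  with tle sq have "t * a > 0" by linarith
  then have a: "a > 0" using t by (simp add: zero_less_mult_iff)
  have "0 \<le> (t - a)\<^sup>2" by simp
  then have "(norm x)\<^sup>2 - a\<^sup>2 \<le> 1" using tle by (simp add: power2_eq_square algebra_simps)
  then have "(norm (x + a *\<^sub>R u))\<^sup>2 \<le> 1" unfolding exp by (simp add: power2_eq_square algebra_simps)
  then have a1: "norm (x + a *\<^sub>R u) \<le> 1" by (simp add: abs_square_le_1)
  have "a \<le> norm u * norm x" unfolding a_def using norm_cauchy_schwarz[of "- u" x] by simp
  then have ax: "a \<le> norm x" using u by simp
  have "(norm (u + x /\<^sub>R norm x))\<^sup>2 = (norm u)\<^sup>2 - 2 * a / norm x + (norm (x /\<^sub>R norm x))\<^sup>2"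
    unfolding power2_norm_eq_inner by (simp add: a_def inner_add inner_commute divide_inverse)
  also have "norm (x /\<^sub>R norm x) = 1" using x by (cases "x = 0") auto
  also have "(norm u)\<^sup>2 - 2 * a / norm x + 1\<^sup>2 = 2 - 2 * a / norm x" using u by simp
  also have "\<dots> \<le> 2 - 2 * (a / norm x)\<^sup>2"
  proof -
    have "a / norm x \<le> 1" "0 \<le> a / norm x" using ax a x by (auto simp: divide_le_eq)
    then have "(a / norm x) * (a / norm x) \<le> (a / norm x) * 1" by (intro mult_left_mono)
    then show ?thesis by (simp add: power2_eq_square)
  qed
  also have "\<dots> = 2 * ((norm x)\<^sup>2 - a\<^sup>2) / (norm x)\<^sup>2"
    using x by (cases "x = 0") (auto simp: power_divide diff_divide_distrib right_diff_distrib)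
  also have "\<dots> \<le> 2 * 1 / (norm x)\<^sup>2"
    using \<open>(norm x)\<^sup>2 - a\<^sup>2 \<le> 1\<close> by (intro divide_right_mono mult_left_mono) auto
  also have "\<dots> \<le> (2 / norm x)\<^sup>2" by (simp add: power_divide divide_right_mono)
  finally have "norm (u + x /\<^sub>R norm x) \<le> 2 / norm x"
    by (rule power2_le_imp_le) simp
  with a ax a1 show thesis by (rule that)
qed

text \<open>
  Let \<open>x1\<close> be the longest vertex: its cone of illuminating directions is the narrowest. The cone of a
  vertex \<open>x\<close> is spanned by the ball of radius \<open>1 / a\<close> about \<open>- x / a\<close>, for any \<open>a > 0\<close>. A direction \<open>u\<close>
  that illuminates both \<open>x1\<close> and \<open>x\<close> is close to the axis \<open>w\<close> of the cone of \<open>x1\<close>. If \<open>a\<close> is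
  the distance from \<open>x\<close> to the foot of the perpendicular on its ray, then \<open>u\<close> is also contained in
  that ball, whose radius is at least \<open>\<sigma> = 1 / norm x1\<close>.
  So a grid about \<open>w\<close> of size proportional to \<open>\<sigma>\<close> hits the cones of all vertices. The remaining
  frontier points are on the unit sphere, where directions near \<open>-y\<close> illuminate \<open>y\<close>.
\<close>

lemma two_illuminable_directions:
  assumes n: "n \<ge> 4" and X: "spiky_vertices n X" "two_illuminable n X"
  shows "\<exists>U\<subseteq>unit_sphere n. finite U \<and> card U \<le> 2 * card (grid n (n\<^sup>2)) \<and>
     (\<forall>y \<in> euclid_top n frontier_of spiky n X. \<exists>u\<in>U. illuminates n (spiky n X) u y)"
proof -
  note XD = spiky_verticesD[OF X(1)]
  obtain x1 where x1: "x1 \<in> X" "\<And>x. x \<in> X \<Longrightarrow> norm x \<le> norm x1"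
    using obtains_MAX[OF XD(1,2), of norm] XD(1) by (metis Max_ge finite_imageI imageI)
  define w where "w = - (x1 /\<^sub>R norm x1)"
  define \<sigma> where "\<sigma> = 1 / norm x1"
  have x1E: "x1 \<in> euclid n" using x1 XD by blast
  have x1n: "norm x1 > 1" using x1 XD by blast
  have x10: "x1 \<noteq> 0" using x1n by (metis norm_zero not_one_less_zero)
  then have \<sigma>: "\<sigma> > 0" by (simp add: \<sigma>_def)
  have w: "w \<in> euclid n" "norm w = 1"
    using x1E x10 by (auto simp: w_def intro!: subspace_neg subspace_scale subspace_euclid)
  let ?g = "grid n (n\<^sup>2)"
  define A where "A = (\<lambda>g. w + (3 * \<sigma>) *\<^sub>R g) ` ?g"
  define U where "U = sgn ` (A \<union> ?g - {0})"
  have "A \<union> ?g \<subseteq> euclid n"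
    using w grid_euclid by (auto simp: A_def intro!: subspace_add subspace_scale subspace_euclid)
  then have U_sphere: "U \<subseteq> unit_sphere n"
    by (auto simp: U_def unit_sphere_def norm_sgn intro!: sgn_euclid split: if_splits)
  have U_fin: "finite U" by (simp add: U_def A_def)
  have "card U \<le> card (A \<union> ?g - {0})" unfolding U_def by (intro card_image_le) (simp add: A_def)
  also have "\<dots> \<le> card (A \<union> ?g)" by (intro card_mono) (auto simp: A_def)
  also have "\<dots> \<le> card A + card ?g" by (rule card_Un_le)
  also have "card A \<le> card ?g" unfolding A_def by (intro card_image_le) simp
  finally have U_card: "card U \<le> 2 * card ?g" by simp
  have vertex: "\<exists>u\<in>U. \<exists>t>0. norm (x + t *\<^sub>R u) < 1" if x: "x \<in> X" for x
  proof -
    have xE: "x \<in> euclid n" and xn: "norm x > 1" using x XD by blast+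
    have "\<exists>u a. u \<in> euclid n \<and> norm (u - w) \<le> 2 * \<sigma> \<and> 0 < a \<and> a \<le> norm x \<and> norm (x + a *\<^sub>R u) \<le> 1"
    proof (cases "x = x1")
      case True
      have "norm x1 *\<^sub>R w = - x1" using x10 by (simp add: w_def)
      with True w \<sigma> x1n show ?thesis by (intro exI[of _ w] exI[of _ "norm x1"]) auto
    next
      case False
      then obtain u where u: "illuminates n (spiky n X) u x" "illuminates n (spiky n X) u x1"
        using X(2) x x1(1) unfolding two_illuminable_def by blast
      then have un: "u \<in> euclid n" "norm u = 1" by (auto simp: illuminates_def unit_sphere_def)
      obtain t where "t > 0" "norm (x + t *\<^sub>R u) \<le> 1"
        by (rule illuminated_vertex_ray_meets_ball[OF X(1) x u(1)])
      then obtain a where a: "0 < a" "a \<le> norm x" "norm (x + a *\<^sub>R u) \<le> 1"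
        using ray_closest_point[OF un(2) _ _ xn] by metis
      obtain t where "t > 0" "norm (x1 + t *\<^sub>R u) \<le> 1"
        by (rule illuminated_vertex_ray_meets_ball[OF X(1) x1(1) u(2)])
      then have "norm (u + x1 /\<^sub>R norm x1) \<le> 2 / norm x1"
        using ray_closest_point[OF un(2) _ _ x1n] by metis
      then have "norm (u - w) \<le> 2 * \<sigma>" by (simp add: w_def \<sigma>_def)
      with un a show ?thesis by blast
    qed
    then obtain u a where u: "u \<in> euclid n" "norm (u - w) \<le> 2 * \<sigma>"
      and a: "0 < a" "a \<le> norm x" "norm (x + a *\<^sub>R u) \<le> 1" by blast
    have scale: "norm (p - (- (x /\<^sub>R a))) = norm (x + a *\<^sub>R p) / a" for p
    proof -
      have "p - (- (x /\<^sub>R a)) = (1 / a) *\<^sub>R (x + a *\<^sub>R p)" using a by (simp add: algebra_simps divide_inverse)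
      then show ?thesis using a by simp
    qed
    have "norm (- (x /\<^sub>R a) - u) \<le> 1 / a"
      using scale[of u] a by (simp add: norm_minus_commute[of "- (x /\<^sub>R a)" u] divide_right_mono)
    moreover have "\<sigma> \<le> 1 / a" using a x1(2)[OF x] x10 by (auto simp: \<sigma>_def intro!: divide_left_mono)
    moreover have "- (x /\<^sub>R a) \<in> euclid n" using xE by (intro subspace_neg subspace_scale subspace_euclid)
    ultimately obtain g where g: "g \<in> ?g" "norm (w + (3 * \<sigma>) *\<^sub>R g - (- (x /\<^sub>R a))) < 1 / a"
      using grid_hits_touching_ball[OF n w(1) u(1) _ \<sigma> _ u(2), of "- (x /\<^sub>R a)" "1 / a"] by blast
    define p where "p = w + (3 * \<sigma>) *\<^sub>R g"
    have p: "norm (x + a *\<^sub>R p) < 1"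
      using g(2) a unfolding p_def[symmetric] scale by (simp add: divide_less_cancel)
    then have p0: "p \<noteq> 0" using xn by auto
    with g have "sgn p \<in> U" by (auto simp: U_def A_def p_def)
    moreover have "(a * norm p) *\<^sub>R sgn p = a *\<^sub>R p" using p0 by (simp add: sgn_div_norm)
    ultimately show ?thesis using p a p0 by (intro bexI[of _ "sgn p"] exI[of _ "a * norm p"]) auto
  qed
  have "\<exists>u\<in>U. illuminates n (spiky n X) u y" if y: "y \<in> euclid_top n frontier_of spiky n X" for y
  proof -
    have "y \<in> spiky n X" using frontier_spiky_subset[OF XD(1,3)] y by blast
    then obtain x where x: "x \<in> X" "y \<in> spike n x" by (auto simp: spiky_def)
    then have "x \<in> euclid n" using XD by blast
    from in_spike_iff[OF this, of y] x(2)
    obtain l where l: "y \<in> euclid n" "0 \<le> l" "l \<le> 1" "norm (y - (1 - l) *\<^sub>R x) \<le> l" by auto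
    show ?thesis
    proof (cases "l < 1")
      case True
      obtain u t where "u \<in> U" "t > 0" "norm (x + t *\<^sub>R u) < 1" using vertex[OF x(1)] by blast
      with illuminates_spike_point[OF XD(3) x(1) y l(1,2) True l(4)] U_sphere show ?thesis by blast
    next
      case False
      with l have y1: "norm y \<le> 1" by simp
      have "\<not> norm y < 1"
        using open_ball_interior_spiky[OF XD(2) l(1)] y by (auto simp: frontier_of_def)
      with y1 have yn: "norm y = 1" by simp
      have my: "- y \<in> euclid n" using l by (intro subspace_neg subspace_euclid)
      obtain g where g: "g \<in> ?g" "norm (- y - g) \<le> 1 / real n"
        using grid_approx_square[OF my] yn n by auto
      have "norm (- y - g) < 1" using g(2) n by (auto intro!: le_less_trans[OF g(2)])
      then have "(norm (- y - g))\<^sup>2 < 1" by (simp add: abs_square_less_1)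
      moreover have "(norm (- y - g))\<^sup>2 = 1 + 2 * inner g y + (norm g)\<^sup>2"
        using yn unfolding power2_norm_eq_inner by (simp add: inner_diff inner_add inner_commute norm_eq_1)
      ultimately have "2 * inner g y + (norm g)\<^sup>2 < 0" by simp
      then have "inner g y < 0" using zero_le_power2[of "norm g"] by linarith
      moreover from this have "g \<noteq> 0" by auto
      ultimately have "inner (sgn g) y < 0" "sgn g \<in> U"
        using g(1) by (auto simp: sgn_div_norm U_def divide_neg_pos mult_pos_neg)
      with illuminates_sphere_point[OF XD(2) y l(1) y1] U_sphere show ?thesis by blast
    qed
  qed
  with U_sphere U_fin U_card show ?thesis by blast
qed

lemma illumination_number_attained:
  assumes n: "n \<ge> 4" and X: "spiky_vertices n X" "two_illuminable n X"
  shows "illumination_number n (spiky n X) \<le> 2 * card (grid n (n\<^sup>2))"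
    and "\<exists>U\<subseteq>unit_sphere n. finite U \<and> card U = illumination_number n (spiky n X) \<and>
        (\<forall>y \<in> euclid_top n frontier_of spiky n X. \<exists>u\<in>U. illuminates n (spiky n X) u y)"
proof -
  let ?P = "\<lambda>m. \<exists>U\<subseteq>unit_sphere n. finite U \<and> card U = m \<and>
        (\<forall>y \<in> euclid_top n frontier_of spiky n X. \<exists>u\<in>U. illuminates n (spiky n X) u y)"
  obtain U where U: "U \<subseteq> unit_sphere n" "finite U" "card U \<le> 2 * card (grid n (n\<^sup>2))"
    "\<forall>y \<in> euclid_top n frontier_of spiky n X. \<exists>u\<in>U. illuminates n (spiky n X) u y"
    using two_illuminable_directions[OF n X] by blast
  then have P: "?P (card U)" by blast
  show "illumination_number n (spiky n X) \<le> 2 * card (grid n (n\<^sup>2))"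
    using Least_le[of ?P, OF P] U(3) unfolding illumination_number_def by linarith
  show "?P (illumination_number n (spiky n X))"
    unfolding illumination_number_def using P by (rule LeastI)
qed

text \<open>
  The uniform bound makes the set whose maximum is \<open>I_s n\<close> finite.
\<close>

lemma illumination_number_le_I_s:
  assumes n: "n \<ge> 4" and X: "spiky_vertices n X" "two_illuminable n X"
  shows "illumination_number n (spiky n X) \<le> I_s n"
  unfolding I_s_def
proof (rule Max_ge)
  show "finite {illumination_number n (spiky n X) | X. spiky_vertices n X \<and> two_illuminable n X}"
    by (rule finite_subset[of _ "{..2 * card (grid n (n\<^sup>2))}"])
       (use illumination_number_attained(1)[OF n] in auto)
qed (use X in blast)

section \<open>The spiky ball over a code\<close>

lemma radius: "2 / sqrt 3 > 1"
proof -
  have "sqrt 3 < sqrt 4" by (simp only: real_sqrt_less_iff)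
  then show ?thesis by simp
qed

context spread_code
begin

text \<open>
  The radius is \<open>1 / sin (\<pi>/3)\<close>, so that the cones at the vertices have half angle \<open>\<pi>/3\<close>.
\<close>

definition vertices :: "fsvec set" where
  "vertices = (\<lambda>i. (2 / sqrt 3) *\<^sub>R v i) ` {..<N}"

lemma vertices_norm: "x \<in> vertices \<Longrightarrow> x \<in> euclid n \<and> norm x = 2 / sqrt 3"
  using v by (auto simp: vertices_def intro!: subspace_scale subspace_euclid)

lemma spike_norm:
  assumes "norm (y - (1 - l) *\<^sub>R x) \<le> l" "0 \<le> l" "l \<le> 1"
  shows "norm (y :: fsvec) \<le> (1 - l) * norm x + l"
proof -
  have "norm y \<le> norm ((1 - l) *\<^sub>R x) + norm (y - (1 - l) *\<^sub>R x)" by (rule norm_triangle_sub)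
  with assms show ?thesis by simp
qed

text \<open>
  All vertices have the same norm, and a spike contains only one point that is as long as its vertex.
\<close>

lemma spiky_vertices_vertices:
  assumes "N > 0"
  shows "spiky_vertices n vertices"
  unfolding spiky_vertices_def
proof (intro conjI ballI)
  show "vertices \<subseteq> euclid n - unit_ball n"
    using vertices_norm radius by (fastforce simp: unit_ball_def)
  fix x assume x: "x \<in> vertices"
  have "x \<in> spike n x" by (rule hull_inc) simp
  with x have "x \<in> spiky n vertices" unfolding spiky_def by blast
  moreover have "x \<notin> spiky n (vertices - {x})"
  proof
    assume "x \<in> spiky n (vertices - {x})"
    then obtain z where z: "z \<in> vertices" "z \<noteq> x" "x \<in> spike n z" by (auto simp: spiky_def)
    then obtain l where l: "0 \<le> l" "l \<le> 1" "norm (x - (1 - l) *\<^sub>R z) \<le> l"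
      using in_spike_iff[of z n x] vertices_norm by auto
    have "2 / sqrt 3 \<le> (1 - l) * (2 / sqrt 3) + l"
      using spike_norm[OF l(3,1,2)] vertices_norm[OF x] vertices_norm[OF z(1)] by simp
    then have "l * (2 / sqrt 3) \<le> l" unfolding left_diff_distrib by linarith
    moreover have "l * 1 < l * (2 / sqrt 3)" if "l \<noteq> 0"
      using that l(1) radius by (intro mult_strict_left_mono) auto
    ultimately have "l = 0" by force
    with l z show False by simp
  qed
  ultimately show "spiky n vertices \<noteq> spiky n (vertices - {x})" by blast
qed (use assms in \<open>auto simp: vertices_def\<close>)

lemma vertices_frontier:
  assumes x: "x \<in> vertices"
  shows "x \<in> euclid_top n frontier_of spiky n vertices"
proof -
  let ?r = "2 / sqrt 3"
  have xE: "x \<in> euclid n" "norm x = ?r" using vertices_norm[OF x] by auto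
  have "x \<in> spike n x" by (rule hull_inc) simp
  with x have "x \<in> spiky n vertices" unfolding spiky_def by blast
  then have "x \<in> euclid_top n closure_of spiky n vertices"
    using xE closure_of_subset_Int[of "euclid_top n" "spiky n vertices"] by auto
  moreover have "x \<notin> euclid_top n interior_of spiky n vertices"
  proof
    assume "x \<in> euclid_top n interior_of spiky n vertices"
    then obtain e where e: "e > 0" "ball x e \<inter> euclid n \<subseteq> spiky n vertices"
      by (auto simp: interior_of_euclid_top)
    define y where "y = (1 + e / 4) *\<^sub>R x"
    have "sqrt 3 > 1" by simp
    then have "?r < 2" by (simp add: divide_less_eq)
    then have "e / 4 * ?r < e / 4 * 4" using e(1) by (intro mult_strict_left_mono) auto
    moreover have "dist x y = e / 4 * ?r"
    proof -
      have "x - y = - ((e / 4) *\<^sub>R x)" by (simp add: y_def algebra_simps)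
      then show ?thesis using e(1) xE by (simp add: dist_norm)
    qed
    ultimately have "dist x y < e / 4 * 4" by (simp only:)
    then have "y \<in> ball x e" by simp
    moreover have "y \<in> euclid n" using xE by (auto simp: y_def intro!: subspace_scale subspace_euclid)
    ultimately have "y \<in> spiky n vertices" using e(2) by blast
    then obtain z where z: "z \<in> vertices" "y \<in> spike n z" by (auto simp: spiky_def)
    then obtain l where l: "0 \<le> l" "l \<le> 1" "norm (y - (1 - l) *\<^sub>R z) \<le> l"
      using in_spike_iff[of z n y] vertices_norm by auto
    have "norm y \<le> (1 - l) * ?r + l" using spike_norm[OF l(3,1,2)] vertices_norm[OF z(1)] by simp
    also have "\<dots> \<le> (1 - l) * ?r + l * ?r" 
      using mult_left_mono[of 1 ?r l] radius l(1) by simp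
    also have "\<dots> = ?r" by (simp only: distrib_right[symmetric]) simp
    also have "\<dots> < (1 + e / 4) * ?r" 
      using mult_strict_right_mono[of 1 "1 + e / 4" ?r] e(1) by simp
    also have "\<dots> = norm y" using e(1) xE by (simp add: y_def)
    finally show False by simp
  qed
  ultimately show ?thesis by (simp add: frontier_of_def)
qed

text \<open>
  The segment from \<open>x\<close> in the direction opposite to the sum of the two code vectors reaches half
  the difference of \<open>x\<close> and \<open>y\<close>, and likewise from \<open>y\<close>. The norm of this is less than 1, because the
  code vectors are less than \<open>\<surd>3\<close> apart.
\<close>

lemma two_illuminable_vertices: "two_illuminable n vertices"
  unfolding two_illuminable_def
proof (intro ballI impI)
  fix x y assume x: "x \<in> vertices" and y: "y \<in> vertices" and "x \<noteq> y"
  then obtain i j where ij: "i < N" "j < N" "i \<noteq> j"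
    "x = (2 / sqrt 3) *\<^sub>R v i" "y = (2 / sqrt 3) *\<^sub>R v j" by (auto simp: vertices_def)
  define z where "z = v i + v j"
  have "inner z (v i) > 0"
    using spread[OF ij(1,2,3)] v(2)[OF ij(1)] by (simp add: z_def inner_add inner_commute norm_eq_1)
  then have z0: "z \<noteq> 0" by auto
  have zE: "z \<in> euclid n" using v ij by (auto simp: z_def intro!: subspace_add subspace_euclid)
  define u where "u = - sgn z"
  define t where "t = norm z / sqrt 3"
  have t: "t > 0" using z0 by (simp add: t_def)
  have u: "u \<in> unit_sphere n"
    using z0 zE by (auto simp: u_def unit_sphere_def norm_sgn intro!: subspace_neg sgn_euclid subspace_euclid)
  have tu: "t *\<^sub>R u = - ((1 / sqrt 3) *\<^sub>R z)" using z0 by (simp add: t_def u_def sgn_div_norm divide_inverse)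
  have two: "(2 / sqrt 3) *\<^sub>R b = (1 / sqrt 3) *\<^sub>R b + (1 / sqrt 3) *\<^sub>R b" for b :: fsvec
    by (simp flip: scaleR_add_left)
  have "x + t *\<^sub>R u = (1 / sqrt 3) *\<^sub>R (v i - v j)"
    unfolding tu ij two z_def scaleR_add_right scaleR_diff_right by simp 
  then have "norm (x + t *\<^sub>R u) < 1"
    using dist_v[OF ij(1,2,3)] by (simp add: divide_less_eq)
  moreover have "y + t *\<^sub>R u = (1 / sqrt 3) *\<^sub>R (v j - v i)"
    unfolding tu ij two z_def scaleR_add_right scaleR_diff_right by simp
  then have "norm (y + t *\<^sub>R u) < 1"
    using dist_v[OF ij(2,1)] ij(3) by (simp add: divide_less_eq)
  moreover have "vertices \<subseteq> euclid n" using vertices_norm by blast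
  ultimately have "illuminates n (spiky n vertices) u x" "illuminates n (spiky n vertices) u y"
    using illuminates_spike_point[of vertices n x x 0 u t] illuminates_spike_point[of vertices n y y 0 u t]
      x y u t vertices_frontier vertices_norm by auto
  then show "\<exists>u. illuminates n (spiky n vertices) u x \<and> illuminates n (spiky n vertices) u y" by blast
qed

text \<open>
  If the ray from \<open>(2 / \<surd>3) v i\<close> in direction \<open>u\<close> meets the unit ball, then the inequality
  of the means gives \<open>(- u) \<bullet> v i \<ge> 1/2\<close>. So the opposites of illuminating directions are the centres of
  a covering of the code by caps.
\<close>

lemma le_I_s:
  assumes n: "n \<ge> 4"
  shows "N \<le> I_s n * K"
proof (cases "N = 0")
  case False
  then have X: "spiky_vertices n vertices" by (intro spiky_vertices_vertices) simp
  obtain U where U: "U \<subseteq> unit_sphere n" "finite U" "card U = illumination_number n (spiky n vertices)"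
    "\<forall>y \<in> euclid_top n frontier_of spiky n vertices. \<exists>u\<in>U. illuminates n (spiky n vertices) u y"
    using illumination_number_attained(2)[OF n X two_illuminable_vertices] by blast
  have "N \<le> card (uminus ` U) * K"
  proof (rule caps_needed)
    fix i assume i: "i < N"
    define x where "x = (2 / sqrt 3) *\<^sub>R v i"
    have x: "x \<in> vertices" using i by (auto simp: x_def vertices_def)
    then obtain u where u: "u \<in> U" "illuminates n (spiky n vertices) u x"
      using U(4) vertices_frontier by blast
    obtain t where t: "t > 0" "norm (x + t *\<^sub>R u) \<le> 1"
      by (rule illuminated_vertex_ray_meets_ball[OF X x u(2)])
    have un: "norm u = 1" using u U(1) by (auto simp: unit_sphere_def)
    have "(norm (x + t *\<^sub>R u))\<^sup>2 = 4 / 3 + 4 / sqrt 3 * t * inner u (v i) + t\<^sup>2"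
      using v(2)[OF i] un unfolding power2_norm_eq_inner
      by (simp add: x_def inner_add inner_commute norm_eq_1 power2_eq_square)
    moreover have "(norm (x + t *\<^sub>R u))\<^sup>2 \<le> 1" using t by (simp add: abs_square_le_1)
    ultimately have le: "1 / 3 + t\<^sup>2 \<le> 4 / sqrt 3 * t * (- inner u (v i))" by simp
    have "0 \<le> (t - 1 / sqrt 3)\<^sup>2" by simp
    then have "2 / sqrt 3 * t \<le> 1 / 3 + t\<^sup>2" by (simp add: power2_diff power_divide)
    with le have "(2 / sqrt 3 * t) * 1 \<le> (2 / sqrt 3 * t) * (2 * (- inner u (v i)))" by simp
    then have "1 / 2 \<le> inner (- u) (v i)"
      using t by (subst (asm) mult_le_cancel_left_pos) auto
    with u(1) show "\<exists>u\<in>uminus ` U. 1 / 2 \<le> inner u (v i)" by blast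
  qed (use U in \<open>auto simp: unit_sphere_def intro!: subspace_neg subspace_euclid\<close>)
  also have "\<dots> \<le> I_s n * K"
    using card_image_le[OF U(2), of uminus] U(3)
      illumination_number_le_I_s[OF n X two_illuminable_vertices] by simp
  finally show ?thesis .
qed simp

end

section \<open>Asymptotics\<close>

text \<open>
  \<open>1 - (1/2 - 1/n)\<^sup>2 \<le> 3/4 (1 + 4/(3n))\<close>, and the \<open>n\<close>-th power of the square root of the second factor stays
  below \<open>exp (2/3)\<close>.
\<close>

lemma cap_volume_bound_le:
  assumes n: "n > 0"
  shows "sqrt (1 - (1 / 2 - 1 / real n)\<^sup>2) ^ n \<le> 3 * (sqrt 3 / 2) ^ n"
proof -
  define x where "x = 4 / (3 * real n)"
  have x: "x > 0" using n by (simp add: x_def)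
  have "1 - (1 / 2 - 1 / real n)\<^sup>2 = 3 / 4 * (1 + x) - (1 / real n)\<^sup>2"
    by (simp add: x_def power2_diff power_divide algebra_simps)
  also have "\<dots> \<le> 3 / 4 * (1 + x)" using zero_le_power2[of "1 / real n"] by linarith
  also have "\<dots> \<le> 3 / 4 * exp x" by (intro mult_left_mono exp_ge_add_one_self) simp
  also have "\<dots> = (sqrt 3 / 2 * exp (x / 2))\<^sup>2"
    by (simp add: power_mult_distrib power_divide exp_double[symmetric])
  finally have "sqrt (1 - (1 / 2 - 1 / real n)\<^sup>2) \<le> sqrt 3 / 2 * exp (x / 2)"
    by (rule real_le_lsqrt[rotated]) simp
  moreover have "(1 / 2 - 1 / real n)\<^sup>2 \<le> 1"
  proof -
    have "0 < 1 / real n" "1 / real n \<le> 1" using n by auto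
    then have "\<bar>1 / 2 - 1 / real n\<bar> \<le> 1" by linarith
    then show ?thesis by (simp only: abs_square_le_1)
  qed
  ultimately have "sqrt (1 - (1 / 2 - 1 / real n)\<^sup>2) ^ n \<le> (sqrt 3 / 2 * exp (x / 2)) ^ n"
    by (intro power_mono) auto
  also have "\<dots> = exp (real n * (x / 2)) * (sqrt 3 / 2) ^ n"
    by (simp only: power_mult_distrib exp_of_nat_mult mult.commute)
  also have "real n * (x / 2) = 2 / 3" using n by (simp add: x_def)
  also have "exp (2 / 3) * (sqrt 3 / 2) ^ n \<le> 3 * (sqrt 3 / 2) ^ n"
    by (intro mult_right_mono order.trans[OF _ exp_le]) auto
  finally show ?thesis .
qed

text \<open>
  The code is taken as large as its existence theorem allows.
\<close>

lemma lower_bound_G_I_s: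
  assumes n: "n \<ge> 4"
  shows "(2 / sqrt 3) ^ n / 6 - 1 \<le> real (G n) * real (2 * n\<^sup>2 + 2)"
    and "(2 / sqrt 3) ^ n / 6 - 1 \<le> real (I_s n) * real (2 * n\<^sup>2 + 2)"
proof -
  define p where "p = sqrt (1 - (1 / 2 - 1 / real n)\<^sup>2) ^ n"
  define N where "N = nat \<lfloor>1 / (2 * p)\<rfloor>"
  have "(1 / 2 - 1 / real n)\<^sup>2 \<le> (1 / 2)\<^sup>2" using n by (intro power_mono) (auto simp: field_simps)
  then have p: "p > 0" by (simp add: p_def power2_eq_square)
  then have "real N \<le> 1 / (2 * p)" by (simp add: N_def)
  then have "2 * real N * p \<le> 1" using p by (simp add: field_simps)
  then obtain v where "spread_code n N (2 * n\<^sup>2 + 2) v"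
    using spread_code_exists[of n N] n by (auto simp: p_def)
  then interpret spread_code n N "2 * n\<^sup>2 + 2" v .
  have "(2 / sqrt 3) ^ n / 6 = 1 / (2 * (3 * (sqrt 3 / 2) ^ n))" by (simp add: power_divide)
  also have "\<dots> \<le> 1 / (2 * p)"
    using cap_volume_bound_le[of n] n p by (intro divide_left_mono mult_left_mono) (auto simp: p_def)
  also have "\<dots> \<le> real N + 1" unfolding N_def by linarith
  finally have N: "(2 / sqrt 3) ^ n / 6 - 1 \<le> real N" by simp
  have "real N \<le> real (G n * (2 * n\<^sup>2 + 2))" "real N \<le> real (I_s n * (2 * n\<^sup>2 + 2))"
    using le_G[OF n] le_I_s[OF n] by (simp_all only: of_nat_le_iff)
  with N show "(2 / sqrt 3) ^ n / 6 - 1 \<le> real (G n) * real (2 * n\<^sup>2 + 2)"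
    "(2 / sqrt 3) ^ n / 6 - 1 \<le> real (I_s n) * real (2 * n\<^sup>2 + 2)"
    unfolding of_nat_mult by linarith+
qed

text \<open>
  A polynomial factor disappears in the \<open>n\<close>-th root, so it is absorbed by an error term that tends to 0.
\<close>

lemma eventually_ge_power:
  fixes f :: "nat \<Rightarrow> real"
  assumes f: "\<And>n. n \<ge> 4 \<Longrightarrow> (2 / sqrt 3) ^ n / 6 - 1 \<le> f n * real (2 * n\<^sup>2 + 2)"
  shows "\<exists>e :: nat \<Rightarrow> real. e \<in> o(\<lambda>_. 1) \<and> (\<forall>\<^sub>F n in sequentially. f n \<ge> (2 / sqrt 3 - e n) ^ n)"
proof (intro exI conjI)
  define d where "d n = (1 / (12 * (2 * real n ^ 2 + 2))) powr (1 / real n)" for n :: nat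
  let ?e = "\<lambda>n. 2 / sqrt 3 - 2 / sqrt 3 * d n"
  have "d \<longlonglongrightarrow> 1" unfolding d_def by real_asymp
  then have "?e \<longlonglongrightarrow> 2 / sqrt 3 - 2 / sqrt 3 * 1" by (intro tendsto_intros)
  then show "?e \<in> o(\<lambda>_. 1)" by (intro smalloI_tendsto) auto
  \<comment> \<open>As soon as \<open>(2 / \<surd>3)\<^sup>n \<ge> 12\<close>, subtracting 1 costs at most half of \<open>(2 / \<surd>3)\<^sup>n / 6\<close>.\<close>
  obtain m where m: "12 < (2 / sqrt 3) ^ m" using real_arch_pow[OF radius] by blast
  have "12 \<le> (2 / sqrt 3) ^ n" if "n \<ge> m" for n
    using m power_increasing[OF that less_imp_le[OF radius]] by linarith
  then have "\<forall>\<^sub>F n in sequentially. (2 / sqrt 3) ^ n \<ge> 12"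
    unfolding eventually_sequentially by blast
  then show "\<forall>\<^sub>F n in sequentially. f n \<ge> (2 / sqrt 3 - ?e n) ^ n"
    using eventually_ge_at_top[of 4]
  proof eventually_elim
    case (elim n)
    have pos: "2 * real n ^ 2 + 2 > 0" by (simp add: add_nonneg_pos)
    have d: "d n ^ n = 1 / (12 * (2 * real n ^ 2 + 2))"
      using elim pos by (simp add: d_def powr_power)
    have "2 / sqrt 3 - ?e n = 2 / sqrt 3 * d n" by simp
    then have "(2 / sqrt 3 - ?e n) ^ n = ((2 / sqrt 3) ^ n / 12) / (2 * real n ^ 2 + 2)"
      by (simp only: power_mult_distrib d) simp
    also have "\<dots> \<le> ((2 / sqrt 3) ^ n / 6 - 1) / (2 * real n ^ 2 + 2)"
      using elim pos by (intro divide_right_mono) auto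
    also have "\<dots> \<le> f n"
      using f[of n] elim pos by (simp add: divide_le_eq add.commute)
    finally show ?case .
  qed
qed

theorem corollary3:
  shows "(\<exists>e :: nat \<Rightarrow> real. e \<in> o(\<lambda>_. 1) \<and>
            (\<forall>\<^sub>F n in sequentially. real (G n) \<ge> (2 / sqrt 3 - e n) ^ n)) \<and>
         (\<exists>e :: nat \<Rightarrow> real. e \<in> o(\<lambda>_. 1) \<and>
            (\<forall>\<^sub>F n in sequentially. real (I_s n) \<ge> (2 / sqrt 3 - e n) ^ n))"
  using eventually_ge_power[of "\<lambda>n. real (G n)"] eventually_ge_power[of "\<lambda>n. real (I_s n)"] lower_bound_G_I_s by blast

end
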